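(* For every integer $m\ge1$, the lattices $\mathbb{Z}^{4m}$, $D_{4m}$ and $D_{4m}^+$, as well as the lattice $E_8$, the Coxeter–Todd lattice $K_{12}$, the Barnes–Wall lattice $BW_{16}$ and the Leech lattice $\Lambda_{24}$, each have a multiplier of norm $c$ for every positive integer $c$.
   Context: A similarity of norm $c$ is a linear map $\sigma:\mathbb{R}^n\to\mathbb{R}^n$ with $\sigma u\cdot\sigma v=c\,u\cdot v$ for all $u,v$. A multiplier of norm $c$ for a lattice $\Lambda$ is a similarity $\sigma$ of norm $c$ with $\sigma(\Lambda)\subseteq\Lambda$. $D_n$ is the lattice of integer vectors in $\mathbb{Z}^n$ with even coordinate sum, and $D_n^+=D_n\cup(D_n+(\tfrac12,\dots,\tfrac12))$. *)

theory Defs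
  imports "HOL-Analysis.Analysis" "HOL-Library.Z2" "HOL-Number_Theory.Cong"
begin

definition similarity :: "real \<Rightarrow> ('a::euclidean_space \<Rightarrow> 'a) \<Rightarrow> bool" where
  "similarity c \<sigma> \<longleftrightarrow> linear \<sigma> \<and> (\<forall>u v. \<sigma> u \<bullet> \<sigma> v = c * (u \<bullet> v))"

definition multiplier :: "real \<Rightarrow> 'a::euclidean_space set \<Rightarrow> ('a \<Rightarrow> 'a) \<Rightarrow> bool" where
  "multiplier c \<Lambda> \<sigma> \<longleftrightarrow> similarity c \<sigma> \<and> \<sigma> ` \<Lambda> \<subseteq> \<Lambda>"

definition Z_lattice :: "(real ^ 'n) set" where
  "Z_lattice = {x. \<forall>i. x $ i \<in> \<int>}"

definition D_lattice :: "(real ^ 'n) set" where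
  "D_lattice = {x \<in> Z_lattice. \<exists>k::int. (\<Sum>i\<in>UNIV. x $ i) = 2 * of_int k}"

definition D_plus :: "(real ^ 'n) set" where
  "D_plus = D_lattice \<union> (\<lambda>x. x + (\<chi> i. 1/2)) ` D_lattice"

definition E8_lattice :: "(real ^ 8) set" where
  "E8_lattice = D_plus"

text \<open>
  The Eisenstein integers. The Coxeter--Todd lattice is taken in the form of its complex
  construction: those vectors of Eisenstein integers that reduce modulo 2 to a word of the
  hexacode (a, b, c, f(1), f(w), f(w^2)), where f(z) = a z^2 + b z + c is a polynomial over
  the field with four elements and w is the class of \<open>\<omega>\<close>. The ambient space \<open>complex ^ 6\<close>
  carries the inner product Re (sum of x_i * cnj y_i), so it is Euclidean 12-space.
\<close>

definition \<omega> :: complex where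
  "\<omega> = cis (2 * pi / 3)"

definition Eisenstein :: "complex set" where
  "Eisenstein = {of_int a + of_int b * \<omega> | a b. True}"

definition K12_lattice :: "(complex ^ 6) set" where
  "K12_lattice = {x. \<exists>a\<in>Eisenstein. \<exists>b\<in>Eisenstein. \<exists>c\<in>Eisenstein. \<exists>y.
     (\<forall>i. y $ i \<in> Eisenstein) \<and>
     x = vector [a, b, c, a + b + c, a * \<omega>^2 + b * \<omega> + c, a * \<omega> + b * \<omega>^2 + c] + 2 *s y}"

instance bit :: finite
proof
  have "UNIV = {0, 1 :: bit}" by auto
  then show "finite (UNIV :: bit set)" by (metis finite.emptyI finite_insert)
qed

text \<open>
  The Barnes--Wall lattice is obtained from the first-order Reed--Muller code of length 16
  (the affine functions on the vector space \<open>bit ^ 4\<close>) by Construction B: Euclidean 16-space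
  has its coordinates labelled by the 16 points of \<open>bit ^ 4\<close>. Note that \<open>of_int\<close> into
  \<open>bit\<close> is reduction modulo 2.
\<close>

definition reed_muller :: "(bit ^ (bit ^ 4)) set" where
  "reed_muller = {(\<chi> v. b + (\<Sum>i\<in>UNIV. a $ i * v $ i)) | a b. True}"

definition BW16_lattice :: "(real ^ (bit ^ 4)) set" where
  "BW16_lattice = {(\<chi> v. of_int (z $ v) / sqrt 2) | z :: int ^ (bit ^ 4).
     (\<chi> v. of_int (z $ v)) \<in> reed_muller \<and> [(\<Sum>v\<in>UNIV. z $ v) = 0] (mod 4)}"

text \<open>
  The 24 coordinates of the binary Golay code and of the Leech lattice are labelled by the
  projective line over the field with 23 elements: \<open>Some j\<close> for j in that field (the numeral
  type \<open>23\<close> of integers mod 23), and \<open>None\<close> for infinity. The Golay code is the extended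
  quadratic residue code, spanned by the translates of the set of nonzero squares, each
  extended by infinity.
\<close>

definition golay_code :: "(bit ^ (23 option)) set" where
  "golay_code = vec.span (range (\<lambda>i::23. \<chi> p. case p of
       None \<Rightarrow> 1
     | Some j \<Rightarrow> of_bool (\<exists>r. r \<noteq> 0 \<and> j - i = r^2)))"

definition Leech_lattice :: "(real ^ (23 option)) set" where
  "Leech_lattice = {(\<chi> p. of_int (z $ p) / sqrt 8) | z :: int ^ (23 option).
     \<exists>m::int. (\<forall>p. [z $ p = m] (mod 2)) \<and>
       [(\<Sum>p\<in>UNIV. z $ p) = 4 * m] (mod 8) \<and>
       (\<forall>k::int. (\<chi> p. of_bool ([z $ p = k] (mod 4))) \<in> golay_code)}"

end

theory Submission
  imports Defs
begin

text \<open>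
  Let \<open>T\<close> and \<open>J\<close> be isometries preserving a lattice with \<open>T\<^sup>2 = e T - 1\<close>, \<open>J\<^sup>2 = -1\<close> and
  \<open>J T = (e - T) J\<close> for some \<open>e \<in> {0, 1}\<close>. Then \<open>x + y T + (z + w T) J\<close> is a multiplier of norm
  \<open>x\<^sup>2 + e x y + y\<^sup>2 + z\<^sup>2 + e z w + w\<^sup>2\<close>. This form represents every positive integer, by Lagrange's
  descent, which works for both values of \<open>e\<close>. So it suffices to find such a pair for each lattice.
  For \<open>K\<^sub>1\<^sub>2\<close> one takes \<open>e = 1\<close>, with multiplication by \<open>1 + \<omega>\<close> and a conjugate-linear map
  \<open>J\<close>. For the other lattices \<open>e = 0\<close> and \<open>T, J\<close> are anticommuting signed permutations of the
  coordinates; for the Leech lattice they come from a quaternion subgroup of \<open>SL\<^sub>2(23)\<close>.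
\<close>

section \<open>Two universal quaternary forms\<close>

text \<open>The value \<open>e = 1\<close> suits \<open>K12_lattice\<close> because its evident
  isometries are scalars: the sixth root of unity 1 + \<omega> satisfies theta^2 = theta - 1. For a
  signed permutation, T^2 = -1 means that the permutation pairs off the coordinates and that
  partners carry opposite signs. In the Barnes-Wall and Leech lattices the signs come from a
  codeword, so the permutation must exchange that codeword with its complement. For the Golay code
  the word is infinity together with the nonzero squares modulo 23, and z -> -1/z exchanges it with
  its complement since -1 is not a square. The second Leech generator must commute with z -> -1/z as
  a permutation while the matrices anticommute. A symmetric matrix of trace zero does this: z -> (a
  z + 1)/(z - a) = a + (a^2 + 1)/(z - a). Scalings by squares preserve the code, so -(a^2 + 1)
  should be a nonzero square; a = 12 gives 12^2 + 1 = -16 modulo 23, with 16 = 4^2.\<close>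

text \<open>The norm of \<open>(x + y \<theta>) + (z + w \<theta>) j\<close>, where \<open>\<theta>\<^sup>2 = e \<theta> - 1\<close>, \<open>j\<^sup>2 = -1\<close> and
  \<open>j \<theta> = (e - \<theta>) j\<close>.\<close>

definition quaternary_form :: "int \<Rightarrow> int \<Rightarrow> int \<Rightarrow> int \<Rightarrow> int \<Rightarrow> int" where
  "quaternary_form e x y z w = x\<^sup>2 + e * x * y + y\<^sup>2 + z\<^sup>2 + e * z * w + w\<^sup>2"

text \<open>Multiplicativity of the norm for \<open>p\<close> times the conjugate of \<open>q\<close>: if \<open>p\<close> and \<open>q\<close> are congruent
  modulo \<open>m\<close> and \<open>m\<close> divides their norms, then \<open>m\<close> divides every argument on the right.\<close>

lemma quaternary_form_mult:
  "quaternary_form e x y z w * quaternary_form e a b c d =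
   quaternary_form e (x*a + e*x*b + y*b + z*c + e*z*d + w*d) (y*a - x*b + w*c - z*d)
     (z*a - w*b - x*c + y*d) (z*b + w*a + e*w*b - x*d - y*c - e*y*d)"
  unfolding quaternary_form_def by algebra

lemma quaternary_form_scale:
  "quaternary_form e (m*x) (m*y) (m*z) (m*w) = m\<^sup>2 * quaternary_form e x y z w"
  unfolding quaternary_form_def by algebra

lemma binary_form_nonneg:
  fixes x y e :: int
  assumes "e \<in> {0, 1}"
  shows "0 \<le> x\<^sup>2 + e * x * y + y\<^sup>2"
proof -
  have "4 * (x\<^sup>2 + e * x * y + y\<^sup>2) = (2*x + e*y)\<^sup>2 + (4 - e\<^sup>2) * y\<^sup>2" by algebra
  moreover have "(4 - e\<^sup>2) * y\<^sup>2 \<ge> 0" using assms by auto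
  ultimately show ?thesis by (smt (verit) zero_le_power2)
qed

lemma quaternary_form_nonneg:
  "e \<in> {0, 1} \<Longrightarrow> 0 \<le> quaternary_form e x y z w"
  unfolding quaternary_form_def
  using binary_form_nonneg[of e x y] binary_form_nonneg[of e z w] by linarith

lemma centered_residue:
  fixes x m :: int
  assumes "m > 0"
  obtains k where "\<bar>2 * (x - m * k)\<bar> \<le> m"
proof -
  define r k where "r = x mod m" and "k = x div m"
  have r: "0 \<le> r" "r < m" "x - m * k = r"
    using assms by (auto simp: r_def k_def minus_mult_div_eq_mod)
  show thesis
  proof (cases "2 * r \<le> m")
    case True
    then show ?thesis using r that[of k] by auto
  next
    case False
    have "x - m * (k + 1) = r - m" using r(3) by (simp add: algebra_simps)
    then show ?thesis using r False that[of "k + 1"] by auto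
  qed
qed

text \<open>For \<open>e = 0\<close> it suffices to centre both coordinates. For
  \<open>e = 1\<close> this would only bound the form by 3/4 m^2, and two such pairs can exceed
  \<open>m^2\<close>; so \<open>y\<close> is centred first and then \<open>2*x + b\<close>, which
  gives 7/16 m^2. Equality with 1/2 m^2 is therefore possible for \<open>e = 0\<close> only.\<close>

lemma binary_form_reduce:
  fixes x y m e :: int
  assumes "m > 0" "e \<in> {0, 1}"
  obtains k l where "2 * ((x - m*k)\<^sup>2 + e * (x - m*k) * (y - m*l) + (y - m*l)\<^sup>2) \<le> m\<^sup>2"
    and "2 * ((x - m*k)\<^sup>2 + e * (x - m*k) * (y - m*l) + (y - m*l)\<^sup>2) = m\<^sup>2 \<longrightarrow>
      e = 0 \<and> \<bar>2 * (x - m*k)\<bar> = m \<and> \<bar>2 * (y - m*l)\<bar> = m"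
proof -
  obtain l where l: "\<bar>2 * (y - m * l)\<bar> \<le> m" using centered_residue[OF assms(1)] .
  define b where "b = y - m * l"
  from assms(2) consider "e = 0" | "e = 1" by blast
  then show thesis
  proof cases
    case 1
    obtain k where k: "\<bar>2 * (x - m * k)\<bar> \<le> m" using centered_residue[OF assms(1)] .
    define a where "a = x - m * k"
    have "(2*a)\<^sup>2 \<le> m\<^sup>2" "(2*b)\<^sup>2 \<le> m\<^sup>2"
      using k l assms(1) by (simp_all add: a_def b_def flip: abs_le_square_iff)
    moreover have "(2*a)\<^sup>2 = 4 * a\<^sup>2" "(2*b)\<^sup>2 = 4 * b\<^sup>2" by (simp_all add: power2_eq_square)
    ultimately have le: "2 * (a\<^sup>2 + b\<^sup>2) \<le> m\<^sup>2" and
      eq: "2 * (a\<^sup>2 + b\<^sup>2) = m\<^sup>2 \<longrightarrow> (2*a)\<^sup>2 = m\<^sup>2 \<and> (2*b)\<^sup>2 = m\<^sup>2"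
      by (auto simp: distrib_left)
    have "2 * (a\<^sup>2 + b\<^sup>2) = m\<^sup>2 \<longrightarrow> \<bar>2*a\<bar> = m \<and> \<bar>2*b\<bar> = m"
      using eq assms(1) by (metis abs_eq_iff abs_of_pos power2_eq_iff)
    then have "2 * (a\<^sup>2 + e*a*b + b\<^sup>2) = m\<^sup>2 \<longrightarrow> e = 0 \<and> \<bar>2*a\<bar> = m \<and> \<bar>2*b\<bar> = m"
      "2 * (a\<^sup>2 + e*a*b + b\<^sup>2) \<le> m\<^sup>2"
      using le by (simp_all only: 1 mult_zero_left add_0_right simp_thms)
    then show ?thesis using that[of k l] unfolding a_def b_def by blast
  next
    case 2
    \<comment> \<open>The modulus is \<open>2 * m\<close> because moving \<open>x\<close> by
      \<open>m * k\<close> moves \<open>2*x + b\<close> by \<open>2 * m * k\<close>.\<close>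
    obtain k where k: "\<bar>2 * ((2*x + b) - 2 * m * k)\<bar> \<le> 2 * m"
      using centered_residue[of "2*m" "2*x + b"] assms(1) by auto
    define a where "a = x - m * k"
    have "\<bar>2*a + b\<bar> \<le> m" using k by (simp add: a_def algebra_simps)
    then have "(2*a + b)\<^sup>2 \<le> m\<^sup>2" using assms(1) by (simp flip: abs_le_square_iff)
    moreover have "(2*b)\<^sup>2 \<le> m\<^sup>2"
      using l assms(1) by (simp add: b_def flip: abs_le_square_iff)
    moreover have "16 * (a\<^sup>2 + 1*a*b + b\<^sup>2) = 4 * (2*a + b)\<^sup>2 + 3 * (2*b)\<^sup>2" by algebra
    moreover have "0 < m\<^sup>2" using assms(1) by simp
    ultimately have "2 * (a\<^sup>2 + 1*a*b + b\<^sup>2) < m\<^sup>2" by linarith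
    then have "2 * (a\<^sup>2 + e*a*b + b\<^sup>2) < m\<^sup>2" unfolding 2 .
    then show ?thesis using that[of k l] unfolding a_def b_def by (metis less_imp_le less_irrefl)
  qed
qed

text \<open>Two pairs, each at most half of \<open>m^2\<close>, add up to at most
  \<open>m^2\<close>. The second disjunct is the boundary case, which the descent excludes because
  \<open>m^2\<close> cannot divide \<open>m * p\<close> for \<open>1 < m < p\<close>; this replaces
  the usual separate treatment of even \<open>m\<close>.\<close>

lemma quaternary_form_reduce:
  fixes m e :: int
  assumes "m > 0" "e \<in> {0, 1}"
  obtains k l s t where
    "quaternary_form e (x - m*k) (y - m*l) (z - m* s) (w - m*t) < m\<^sup>2 \<or>
     m\<^sup>2 dvd quaternary_form e x y z w"
proof -
  obtain k l where kl: "2 * ((x - m*k)\<^sup>2 + e * (x - m*k) * (y - m*l) + (y - m*l)\<^sup>2) \<le> m\<^sup>2"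
    "2 * ((x - m*k)\<^sup>2 + e * (x - m*k) * (y - m*l) + (y - m*l)\<^sup>2) = m\<^sup>2 \<longrightarrow>
      e = 0 \<and> \<bar>2 * (x - m*k)\<bar> = m \<and> \<bar>2 * (y - m*l)\<bar> = m"
    using binary_form_reduce[OF assms] .
  obtain s t where st: "2 * ((z - m* s)\<^sup>2 + e * (z - m* s) * (w - m*t) + (w - m*t)\<^sup>2) \<le> m\<^sup>2"
    "2 * ((z - m* s)\<^sup>2 + e * (z - m* s) * (w - m*t) + (w - m*t)\<^sup>2) = m\<^sup>2 \<longrightarrow>
      e = 0 \<and> \<bar>2 * (z - m* s)\<bar> = m \<and> \<bar>2 * (w - m*t)\<bar> = m"
    using binary_form_reduce[OF assms] .
  let ?N = "quaternary_form e (x - m*k) (y - m*l) (z - m* s) (w - m*t)"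
  have N: "2 * ?N = 2 * ((x - m*k)\<^sup>2 + e * (x - m*k) * (y - m*l) + (y - m*l)\<^sup>2)
      + 2 * ((z - m* s)\<^sup>2 + e * (z - m* s) * (w - m*t) + (w - m*t)\<^sup>2)"
    unfolding quaternary_form_def by algebra
  have le: "?N \<le> m\<^sup>2" using kl(1) st(1) N by linarith
  moreover have "m\<^sup>2 dvd quaternary_form e x y z w" if "?N = m\<^sup>2"
  proof -
    have "2 * ((x - m*k)\<^sup>2 + e * (x - m*k) * (y - m*l) + (y - m*l)\<^sup>2) = m\<^sup>2"
      "2 * ((z - m* s)\<^sup>2 + e * (z - m* s) * (w - m*t) + (w - m*t)\<^sup>2) = m\<^sup>2"
      using kl(1) st(1) N that by linarith+
    then have e: "e = 0" and *: "\<bar>2 * (x - m*k)\<bar> = m" "\<bar>2 * (y - m*l)\<bar> = m"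
        "\<bar>2 * (z - m* s)\<bar> = m" "\<bar>2 * (w - m*t)\<bar> = m"
      using kl(2) st(2) by blast+
    \<comment> \<open>All four coordinates are odd multiples of \<open>m/2\<close>, and odd squares are \<open>1\<close> modulo \<open>4\<close>.\<close>
    have odd_mult: "\<exists>j. (2 * u)\<^sup>2 = m\<^sup>2 * (4 * j + 1)" if "\<bar>2 * (u - m * i)\<bar> = m" for u i
    proof -
      from that have "2 * u = m * (2 * i + 1) \<or> 2 * u = m * (2 * i - 1)"
        by (auto simp: abs_if algebra_simps split: if_splits)
      then have "(2*u)\<^sup>2 = m\<^sup>2 * (4 * (i*i + i) + 1) \<or> (2*u)\<^sup>2 = m\<^sup>2 * (4 * (i*i - i) + 1)"
        by (elim disjE) (rule disjI1, algebra, rule disjI2, algebra)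
      then show ?thesis by blast
    qed
    obtain j1 j2 j3 j4 where "(2*x)\<^sup>2 = m\<^sup>2 * (4 * j1 + 1)" "(2*y)\<^sup>2 = m\<^sup>2 * (4 * j2 + 1)"
      "(2*z)\<^sup>2 = m\<^sup>2 * (4 * j3 + 1)" "(2*w)\<^sup>2 = m\<^sup>2 * (4 * j4 + 1)"
      using odd_mult * by meson
    moreover have "4 * quaternary_form e x y z w = (2*x)\<^sup>2 + (2*y)\<^sup>2 + (2*z)\<^sup>2 + (2*w)\<^sup>2"
      by (simp add: quaternary_form_def e power_mult_distrib)
    ultimately have "4 * quaternary_form e x y z w = 4 * (m\<^sup>2 * (j1 + j2 + j3 + j4 + 1))"
      by (simp add: distrib_left)
    then show ?thesis by simp
  qed
  ultimately show thesis using that[of k l s t] by linarith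
qed

section \<open>Every natural number is represented\<close>

definition represented :: "int \<Rightarrow> int \<Rightarrow> bool" where
  "represented e n \<longleftrightarrow> (\<exists>x y z w. n = quaternary_form e x y z w)"

lemma represented_mult: "represented e m \<Longrightarrow> represented e n \<Longrightarrow> represented e (m * n)"
  unfolding represented_def using quaternary_form_mult by metis

text \<open>Pigeonhole: for p = 2h + 1, the values x^2 + e x + 1 and -z^2 with arguments in 0..h are
  h + 1 distinct residues each, so some residue is common. The form at (x, 1, z, 0) is then a
  multiple of p, and the bound h on the arguments keeps it below p^2.\<close>

lemma represented_multiple_of_prime:
  fixes p e :: int
  assumes "prime p" "e \<in> {0, 1}"
  obtains m where "0 < m" "m < p" "represented e (m * p)"
proof (cases "p = 2")
  case True
  have "1 * p = quaternary_form e 0 1 1 0" by (simp add: quaternary_form_def True)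
  then show thesis using that[of 1] True unfolding represented_def
    by (metis less_numeral_extra(1) one_less_numeral_iff semiring_norm(76))
next
  case False
  have odd: "odd p" using assms(1) False prime_ge_2_int[of p] by (intro prime_odd_int) auto
  have p: "p > 2" using assms(1) False prime_ge_2_int[of p] by linarith
  define h where "h = p div 2"
  have h: "p = 2 * h + 1" using odd by (simp add: h_def)
  define f where "f = (\<lambda>x. (x\<^sup>2 + e * x + 1) mod p)"
  define g where "g = (\<lambda>x. (- (x\<^sup>2)) mod p)"
  \<comment> \<open>A difference of two values of \<open>f\<close> or of \<open>g\<close> factors in
    this way, with \<open>e' = e\<close> or \<open>e' = 0\<close>. From \<open>x < y\<close> and
    \<open>y \<le> h\<close> one gets 0 < x + y + e' < p, even for e' = 1.\<close>
  have no: False if "p dvd (x - y) * (x + y + e')" "e' \<in> {0, 1}" "x \<in> {0..h}" "y \<in> {0..h}" "x < y"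
    for x y e'
  proof -
    have "p dvd x - y \<or> p dvd x + y + e'" using that(1) assms(1) prime_dvd_multD by blast
    moreover have "\<not> p dvd y - x" using that h by (auto dest!: zdvd_imp_le)
    moreover have "\<not> p dvd x + y + e'" using that h by (auto dest!: zdvd_imp_le)
    ultimately show False by (metis dvd_minus_iff minus_diff_eq)
  qed
  have no': "x = y" if "p dvd (x - y) * (x + y + e')" "e' \<in> {0, 1}" "x \<in> {0..h}" "y \<in> {0..h}"
    for x y e'
  proof -
    have "(y - x) * (y + x + e') = - ((x - y) * (x + y + e'))" by algebra
    then have "p dvd (y - x) * (y + x + e')" using that(1) by (metis dvd_minus_iff)
    then show ?thesis using no[OF that] no[of y x e'] that by (metis linorder_less_linear)
  qed
  have "inj_on f {0..h}"
  proof (rule inj_onI)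
    fix x y assume *: "x \<in> {0..h}" "y \<in> {0..h}" "f x = f y"
    have "p dvd (x\<^sup>2 + e * x + 1) - (y\<^sup>2 + e * y + 1)"
      using *(3) unfolding f_def by (simp add: mod_eq_dvd_iff)
    also have "(x\<^sup>2 + e * x + 1) - (y\<^sup>2 + e * y + 1) = (x - y) * (x + y + e)" by algebra
    finally show "x = y" using no'[OF _ assms(2) *(1,2)] by blast
  qed
  then have cf: "card (f ` {0..h}) = nat (h + 1)" by (simp add: card_image)
  have "inj_on g {0..h}"
  proof (rule inj_onI)
    fix x y assume *: "x \<in> {0..h}" "y \<in> {0..h}" "g x = g y"
    have "p dvd - (y\<^sup>2) - - (x\<^sup>2)"
      using *(3) unfolding g_def by (metis mod_eq_dvd_iff)
    also have "- (y\<^sup>2) - - (x\<^sup>2) = (x - y) * (x + y + 0)" by algebra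
    finally show "x = y" using no'[OF _ _ *(1,2), of 0] by blast
  qed
  then have cg: "card (g ` {0..h}) = nat (h + 1)" by (simp add: card_image)
  have sub: "f ` {0..h} \<union> g ` {0..h} \<subseteq> {0..<p}" using p by (auto simp: f_def g_def)
  have "f ` {0..h} \<inter> g ` {0..h} \<noteq> {}"
  proof
    assume "f ` {0..h} \<inter> g ` {0..h} = {}"
    then have "card (f ` {0..h} \<union> g ` {0..h}) = nat (h + 1) + nat (h + 1)"
      by (simp add: card_Un_disjoint cf cg)
    moreover have "card (f ` {0..h} \<union> g ` {0..h}) \<le> nat p"
      using card_mono[OF _ sub] by simp
    ultimately show False using h p by linarith
  qed
  then obtain x z where xz: "x \<in> {0..h}" "z \<in> {0..h}" "f x = g z" by blast
  then have "p dvd (x\<^sup>2 + e * x + 1) - - (z\<^sup>2)" unfolding f_def g_def by (metis mod_eq_dvd_iff)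
  then obtain m where m: "x\<^sup>2 + e * x + 1 + z\<^sup>2 = m * p"
    by (metis diff_minus_eq_add dvd_def mult.commute)
  have "x\<^sup>2 \<le> h\<^sup>2" "z\<^sup>2 \<le> h\<^sup>2" using xz by (auto intro: power_mono)
  moreover have ex: "0 \<le> e * x" "e * x \<le> h" using xz assms(2) by auto
  moreover have "p * p = 4 * h\<^sup>2 + 4 * h + 1" unfolding h by algebra
  moreover have "h > 0" using h p by linarith
  ultimately have "m * p < p * p" using m by (smt (verit) zero_le_power2)
  moreover have "0 < m * p" using m ex by (smt (verit) zero_le_power2)
  ultimately have "0 < m" "m < p" using p by (simp_all add: zero_less_mult_iff)
  moreover have "m * p = quaternary_form e x 1 z 0"
    using m by (simp add: quaternary_form_def algebra_simps)
  ultimately show thesis using that unfolding represented_def by metis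
qed

text \<open>Reducing the arguments modulo \<open>m\<close> gives a vector of norm
  \<open>m * q\<close> with \<open>q < m\<close>. The product of both norms is
  \<open>m^2 * (q * p)\<close>, and by \<open>quaternary_form_mult\<close> it is the form at four
  multiples of \<open>m\<close>; cancelling \<open>m^2\<close> represents
  \<open>q * p\<close>.\<close>

lemma represented_descent:
  fixes p e m :: int
  assumes p: "prime p" and e: "e \<in> {0, 1}" and m: "1 < m" "m < p" and rep: "represented e (m * p)"
  obtains m' where "0 < m'" "m' < m" "represented e (m' * p)"
proof -
  from rep obtain x y z w where N: "quaternary_form e x y z w = m * p"
    unfolding represented_def by metis
  obtain k l s t where
    r: "quaternary_form e (x - m*k) (y - m*l) (z - m* s) (w - m*t) < m\<^sup>2 \<or>
     m\<^sup>2 dvd quaternary_form e x y z w"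
    using quaternary_form_reduce[of m e] m e by (metis less_trans zero_less_one)
  have nd: "\<not> m\<^sup>2 dvd m * p"
  proof
    assume "m\<^sup>2 dvd m * p"
    then have "m dvd p" using m by (simp add: power2_eq_square)
    moreover have "0 \<le> m" using m by linarith
    ultimately have "m = 1 \<or> m = p" using p by (simp add: prime_int_iff)
    then show False using m by linarith
  qed
  define a b c d where abcd: "a = x - m*k" "b = y - m*l" "c = z - m* s" "d = w - m*t"
  have x: "x = a + m*k" "y = b + m*l" "z = c + m* s" "w = d + m*t" by (auto simp: abcd)
  have lt: "quaternary_form e a b c d < m\<^sup>2" using r nd N abcd by auto
  \<comment> \<open>The bracket is the difference of the norms of (x, y, z, w) and (a, b, c, d),
    divided by \<open>m\<close>.\<close>
  define q where "q = p - (2*a*k + m*k\<^sup>2 + e*(a*l + k*b + m*k*l) + 2*b*l + m*l\<^sup>2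
    + 2*c* s + m* s\<^sup>2 + e*(c*t + s*d + m* s*t) + 2*d*t + m*t\<^sup>2)"
  have q: "quaternary_form e a b c d = m * q"
    using N unfolding q_def x quaternary_form_def by algebra
  have "q < m" using lt m unfolding q by (simp add: power2_eq_square)
  \<comment> \<open>The form is definite, so \<open>q = 0\<close> would make all residues vanish,
    and \<open>m^2\<close> would divide \<open>m * p\<close>.\<close>
  have "q \<noteq> 0"
  proof
    assume "q = 0"
    then have 0: "quaternary_form e a b c d = 0" using q by simp
    have sq: "u = 0 \<and> v = 0" if "u\<^sup>2 + e*u* v + v\<^sup>2 = 0" for u v
    proof -
      have "(2*u + e* v)\<^sup>2 + (4 - e\<^sup>2) * v\<^sup>2 = 0" using that by algebra
      moreover have "(4 - e\<^sup>2) * v\<^sup>2 \<ge> v\<^sup>2" using e by auto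
      ultimately have "v\<^sup>2 \<le> 0" by (smt (verit) zero_le_power2)
      then have "v = 0" by simp
      then show ?thesis using that by simp
    qed
    have "a\<^sup>2 + e*a*b + b\<^sup>2 = 0" "c\<^sup>2 + e*c*d + d\<^sup>2 = 0"
      using binary_form_nonneg[OF e, of a b] binary_form_nonneg[OF e, of c d] 0
      unfolding quaternary_form_def by linarith+
    then have "a = 0" "b = 0" "c = 0" "d = 0" using sq by blast+
    then have "quaternary_form e x y z w = m\<^sup>2 * quaternary_form e k l s t"
      by (simp add: x quaternary_form_scale)
    then show False using nd N by simp
  qed
  have "0 \<le> m * q" using quaternary_form_nonneg[OF e, of a b c d] q by simp
  then have "0 < q" using \<open>q \<noteq> 0\<close> m by (simp add: zero_le_mult_iff)
  have prod: "m * p * (m * q) = quaternary_form e (x*a + e*x*b + y*b + z*c + e*z*d + w*d)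
      (y*a - x*b + w*c - z*d)
     (z*a - w*b - x*c + y*d) (z*b + w*a + e*w*b - x*d - y*c - e*y*d)"
    using quaternary_form_mult N q by metis
  \<comment> \<open>\<open>P\<close>, \<open>Q\<close>, \<open>R\<close>, \<open>S\<close> are the
    product arguments divided by \<open>m\<close>. The summand \<open>q\<close> of \<open>P\<close>
    comes from the norm of (a, b, c, d), which is \<open>m * q\<close>; the same terms cancel in the
    other three.\<close>
  define P where "P = q + (k*a + e*k*b + l*b + s*c + e* s*d + t*d)"
  define Q where "Q = l*a - k*b + t*c - s*d"
  define R where "R = s*a - t*b - k*c + l*d"
  define S where "S = s*b + t*a + e*t*b - k*d - l*c - e*l*d"
  have "x*a + e*x*b + y*b + z*c + e*z*d + w*d = m * P"
    using q unfolding P_def x quaternary_form_def by algebra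
  moreover have "y*a - x*b + w*c - z*d = m * Q" unfolding Q_def x by algebra
  moreover have "z*a - w*b - x*c + y*d = m * R" unfolding R_def x by algebra
  moreover have "z*b + w*a + e*w*b - x*d - y*c - e*y*d = m * S" unfolding S_def x by algebra
  ultimately have "m * p * (m * q) = m\<^sup>2 * quaternary_form e P Q R S"
    using prod by (simp only: quaternary_form_scale)
  then have "m\<^sup>2 * (q * p) = m\<^sup>2 * quaternary_form e P Q R S"
    by (simp only: power2_eq_square ac_simps)
  then have "represented e (q * p)" using m unfolding represented_def by auto
  then show thesis using that \<open>0 < q\<close> \<open>q < m\<close> by blast
qed

lemma represented_prime:
  fixes p e :: int
  assumes p: "prime p" and e: "e \<in> {0, 1}"
  shows "represented e p"
proof -
  define P where "P = (\<lambda>n. 0 < n \<and> int n < p \<and> represented e (int n * p))"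
  obtain m where "0 < m" "m < p" "represented e (m * p)"
    using represented_multiple_of_prime[OF assms] .
  then have ex: "P (nat m)" by (simp add: P_def)
  define n where "n = (LEAST n. P n)"
  have n: "P n" unfolding n_def using ex by (rule LeastI)
  have "n = 1"
  proof (rule ccontr)
    assume "n \<noteq> 1"
    then have "1 < int n" "int n < p" "represented e (int n * p)" using n by (auto simp: P_def)
    then obtain m' where m': "0 < m'" "m' < int n" "represented e (m' * p)"
      using represented_descent[OF assms] by metis
    then have "P (nat m')" using n by (auto simp: P_def)
    then have "n \<le> nat m'" unfolding n_def by (rule Least_le)
    then show False using m' by linarith
  qed
  then show ?thesis using n by (simp add: P_def)
qed

text \<open>Lagrange's four-square theorem is the case \<open>e = 0\<close>.\<close>

theorem represented_nat:
  fixes e :: int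
  assumes e: "e \<in> {0, 1}"
  shows "represented e (int n)"
proof (induction n rule: prime_divisors_induct)
  case zero
  have "0 = quaternary_form e 0 0 0 0" by (simp add: quaternary_form_def)
  then show ?case unfolding represented_def by (metis of_nat_0)
next
  case (unit n)
  have "1 = quaternary_form e 1 0 0 0" by (simp add: quaternary_form_def)
  then show ?case using unit unfolding represented_def by (metis nat_dvd_1_iff_1 of_nat_1)
next
  case (factor p n)
  then show ?case using represented_mult[of e "int p" "int n"] represented_prime[OF _ e, of "int p"]
    by simp
qed

section \<open>Multipliers from quaternion actions\<close>

lemma int_scaleR_closed:
  fixes \<Lambda> :: "'a::real_vector set"
  assumes sub: "\<And>u v. u \<in> \<Lambda> \<Longrightarrow> v \<in> \<Lambda> \<Longrightarrow> u - v \<in> \<Lambda>" and u: "u \<in> \<Lambda>"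
  shows "of_int k *\<^sub>R u \<in> \<Lambda>"
proof -
  have 0: "0 \<in> \<Lambda>" using sub[OF u u] by simp
  have nat: "of_nat n *\<^sub>R v \<in> \<Lambda>" if "v \<in> \<Lambda>" for n v
  proof (induction n)
    case (Suc n)
    have "of_nat n *\<^sub>R v - (0 - v) \<in> \<Lambda>" using sub Suc 0 that by blast
    then show ?case by (simp add: algebra_simps)
  qed (simp add: 0)
  show ?thesis
  proof (cases k rule: int_cases2)
    case (nonneg n)
    then show ?thesis using nat[OF u] by simp
  next
    case (nonpos n)
    have "0 - of_nat n *\<^sub>R u \<in> \<Lambda>" using sub 0 nat[OF u] by blast
    then show ?thesis using nonpos by simp
  qed
qed

text \<open>The adjoint of an isometry is its inverse, which is e - T for \<open>T\<close> and -J
  for \<open>J\<close>. Hence the adjoint of the combination \<open>\<sigma>\<close> is its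
  quaternion conjugate, the mixed terms collapse, and the norm form remains as the scalar.\<close>

lemma multiplier_of_quaternion_action:
  fixes T J :: "'a::euclidean_space \<Rightarrow> 'a" and e :: int
  assumes linear: "linear T" "linear J"
    and T_iso: "\<And>u v. T u \<bullet> T v = u \<bullet> v" and J_iso: "\<And>u v. J u \<bullet> J v = u \<bullet> v"
    and e: "e \<in> {0, 1}"
    and TT: "\<And>u. T (T u) = of_int e *\<^sub>R T u - u" and JJ: "\<And>u. J (J u) = - u"
    and JT: "\<And>u. J (T u) = of_int e *\<^sub>R J u - T (J u)"
    and sub: "\<And>u v. u \<in> \<Lambda> \<Longrightarrow> v \<in> \<Lambda> \<Longrightarrow> u - v \<in> \<Lambda>"
    and T_closed: "\<And>u. u \<in> \<Lambda> \<Longrightarrow> T u \<in> \<Lambda>" and J_closed: "\<And>u. u \<in> \<Lambda> \<Longrightarrow> J u \<in> \<Lambda>"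
  shows "\<exists>\<sigma>. multiplier (real c) \<Lambda> \<sigma>"
proof -
  obtain x y z w :: int where c: "int c = quaternary_form e x y z w"
    using represented_nat[OF e] unfolding represented_def by metis
  define \<sigma> where "\<sigma> u = of_int x *\<^sub>R u + of_int y *\<^sub>R T u + of_int z *\<^sub>R J u + of_int w *\<^sub>R T (J u)" for u
  have "linear \<sigma>" unfolding \<sigma>_def
    by (intro linear_compose_add linear_compose_scale_right linear_ident linear
      linear_compose[OF linear(2) linear(1), unfolded o_def])
  have "\<sigma> u \<bullet> \<sigma> v = real c * (u \<bullet> v)" for u v
  proof -
    let ?e = "real_of_int e"
    have T_adj: "T a \<bullet> b = ?e * (a \<bullet> b) - a \<bullet> T b" for a b
      using T_iso[of "T a" b] by (simp add: TT inner_diff_left T_iso)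
    have J_adj: "J a \<bullet> b = - (a \<bullet> J b)" for a b
      using J_iso[of "J a" b] by (simp add: JJ)
    have "real c = real_of_int (int c)" by simp
    also have "\<dots> = real_of_int x ^ 2 + ?e * x * y + real_of_int y ^ 2 + real_of_int z ^ 2
        + ?e * z * w + real_of_int w ^ 2"
      unfolding c quaternary_form_def by simp
    finally show ?thesis
      unfolding \<sigma>_def
      by (simp add: inner_add_left inner_add_right inner_diff_right T_adj J_adj TT JJ JT
        linear_neg[OF linear(1)] power2_eq_square algebra_simps)
  qed
  moreover have "\<sigma> u \<in> \<Lambda>" if "u \<in> \<Lambda>" for u
  proof -
    have add: "a + b \<in> \<Lambda>" if "a \<in> \<Lambda>" "b \<in> \<Lambda>" for a b
      using sub[OF that(1) sub[OF sub[OF that(2) that(2)] that(2)]] by simp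
    show ?thesis unfolding \<sigma>_def
      by (intro add int_scaleR_closed sub T_closed J_closed that)
  qed
  ultimately show ?thesis using \<open>linear \<sigma>\<close>
    unfolding multiplier_def similarity_def by blast
qed

section \<open>Quaternion actions by signed permutations\<close>

definition signed_perm :: "('n \<Rightarrow> real) \<Rightarrow> ('n \<Rightarrow> 'n) \<Rightarrow> real ^ 'n \<Rightarrow> real ^ 'n" where
  "signed_perm s \<pi> x = (\<chi> p. s p * x $ \<pi> p)"

lemma signed_perm_nth [simp]: "signed_perm s \<pi> x $ p = s p * x $ \<pi> p"
  by (simp add: signed_perm_def)

lemma linear_signed_perm: "linear (signed_perm s \<pi>)"
  by (rule linearI) (simp_all add: vec_eq_iff algebra_simps)

lemma signed_perm_inner:
  fixes \<pi> :: "'n::finite \<Rightarrow> 'n"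
  assumes "bij \<pi>" "\<And>p. s p \<in> {1, -1}"
  shows "signed_perm s \<pi> x \<bullet> signed_perm s \<pi> y = x \<bullet> y"
proof -
  have "s p * a * (s p * b) = a * b" for p a b using assms(2)[of p] by auto
  then have "signed_perm s \<pi> x \<bullet> signed_perm s \<pi> y = (\<Sum>p\<in>UNIV. x $ \<pi> p * y $ \<pi> p)"
    by (simp only: inner_vec_def signed_perm_nth inner_real_def)
  also have "\<dots> = x \<bullet> y"
    using sum.reindex_bij_betw[OF assms(1), of "\<lambda>p. x $ p * y $ p"] by (simp add: inner_vec_def)
  finally show ?thesis .
qed

text \<open>Read coordinatewise, the involution and twist laws say that both signed permutations
  square to -1; \<open>commute\<close> and \<open>anti\<close> say that they anticommute.\<close>

locale quaternion_signed_perms =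
  fixes s t :: "'n::finite \<Rightarrow> real" and \<pi> \<rho> :: "'n \<Rightarrow> 'n"
  assumes s_sign: "s p \<in> {1, -1}" and t_sign: "t p \<in> {1, -1}"
    and \<pi>_inv [simp]: "\<pi> (\<pi> p) = p" and \<rho>_inv [simp]: "\<rho> (\<rho> p) = p"
    and s_twist: "s p * s (\<pi> p) = -1" and t_twist: "t p * t (\<rho> p) = -1"
    and commute: "\<pi> (\<rho> p) = \<rho> (\<pi> p)" and anti: "s p * t (\<pi> p) = - (t p * s (\<rho> p))"
begin

lemma bij_\<pi>: "bij \<pi>" and bij_\<rho>: "bij \<rho>"
  by (rule o_bij[of \<pi>], auto) (rule o_bij[of \<rho>], auto)

lemma multiplier_exists:
  assumes "\<And>u v. u \<in> \<Lambda> \<Longrightarrow> v \<in> \<Lambda> \<Longrightarrow> u - v \<in> \<Lambda>"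
    and "\<And>u. u \<in> \<Lambda> \<Longrightarrow> signed_perm s \<pi> u \<in> \<Lambda>"
    and "\<And>u. u \<in> \<Lambda> \<Longrightarrow> signed_perm t \<rho> u \<in> \<Lambda>"
  shows "\<exists>\<sigma>. multiplier (real c) \<Lambda> \<sigma>"
proof (rule multiplier_of_quaternion_action[where e = 0 and T = "signed_perm s \<pi>" and J = "signed_perm t \<rho>"])
  show "signed_perm s \<pi> (signed_perm s \<pi> u) = of_int 0 *\<^sub>R signed_perm s \<pi> u - u" for u
    by (simp add: vec_eq_iff s_twist mult.assoc[symmetric])
  show "signed_perm t \<rho> (signed_perm t \<rho> u) = - u" for u
    by (simp add: vec_eq_iff t_twist mult.assoc[symmetric])
  show "signed_perm t \<rho> (signed_perm s \<pi> u) =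
      of_int 0 *\<^sub>R signed_perm t \<rho> u - signed_perm s \<pi> (signed_perm t \<rho> u)" for u
    by (simp add: vec_eq_iff commute anti mult.assoc[symmetric])
  show "signed_perm s \<pi> u \<bullet> signed_perm s \<pi> v = u \<bullet> v" for u v
    by (rule signed_perm_inner[OF bij_\<pi> s_sign])
  show "signed_perm t \<rho> u \<bullet> signed_perm t \<rho> v = u \<bullet> v" for u v
    by (rule signed_perm_inner[OF bij_\<rho> t_sign])
qed (simp_all add: assms linear_signed_perm)

end

section \<open>The lattices Z, D and D+ in dimension 4m\<close>

lemma D_lattice_iff: "x \<in> D_lattice \<longleftrightarrow> x \<in> Z_lattice \<and> (\<exists>k::int. (\<Sum>i\<in>UNIV. x $ i) = 2 * of_int k)"
  by (simp add: D_lattice_def)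

lemma Z_lattice_diff: "x \<in> Z_lattice \<Longrightarrow> y \<in> Z_lattice \<Longrightarrow> x - y \<in> Z_lattice"
  by (simp add: Z_lattice_def)

lemma D_lattice_diff:
  assumes "x \<in> D_lattice" "y \<in> D_lattice"
  shows "x - y \<in> D_lattice"
proof -
  obtain k l :: int where "(\<Sum>i\<in>UNIV. x $ i) = 2 * of_int k" "(\<Sum>i\<in>UNIV. y $ i) = 2 * of_int l"
    using assms by (auto simp: D_lattice_iff)
  then have "(\<Sum>i\<in>UNIV. (x - y) $ i) = 2 * of_int (k - l)" by (simp add: sum_subtractf)
  then show ?thesis using assms Z_lattice_diff unfolding D_lattice_iff by blast
qed

lemma D_plus_iff: "x \<in> D_plus \<longleftrightarrow> x \<in> D_lattice \<or> x - (\<chi> i. 1/2) \<in> D_lattice"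
  by (force simp: D_plus_def image_iff algebra_simps)

text \<open>Twice the glue vector (1/2, ..., 1/2) must lie in \<open>D_lattice\<close> for
  \<open>D_plus\<close> to be a group; its coordinate sum is 4m.\<close>

lemma ones_in_D_lattice:
  assumes "CARD('n::finite) = 4 * m"
  shows "(\<chi> i. (1::real)) \<in> (D_lattice :: (real ^ 'n) set)"
proof -
  have "(\<Sum>i\<in>(UNIV::'n set). (\<chi> i. (1::real)) $ i) = 2 * of_int (2 * int m)" by (simp add: assms)
  moreover have "(\<chi> i. (1::real)) \<in> (Z_lattice :: (real ^ 'n) set)" by (simp add: Z_lattice_def)
  ultimately show ?thesis unfolding D_lattice_iff by blast
qed

lemma D_plus_diff:
  fixes x y :: "real ^ 'n::finite"
  assumes "CARD('n) = 4 * m" "x \<in> D_plus" "y \<in> D_plus"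
  shows "x - y \<in> D_plus"
proof -
  define h :: "real ^ 'n" where "h = (\<chi> i. 1/2)"
  have hh: "h + h \<in> D_lattice"
    using ones_in_D_lattice[OF assms(1)] by (simp add: h_def vec_eq_iff plus_vec_def)
  have "x \<in> D_lattice \<or> x - h \<in> D_lattice" "y \<in> D_lattice \<or> y - h \<in> D_lattice"
    using assms(2,3) by (auto simp: D_plus_iff h_def)
  then consider "x \<in> D_lattice" "y \<in> D_lattice" | "x - h \<in> D_lattice" "y \<in> D_lattice"
    | "x \<in> D_lattice" "y - h \<in> D_lattice" | "x - h \<in> D_lattice" "y - h \<in> D_lattice" by blast
  then have "x - y \<in> D_lattice \<or> x - y - h \<in> D_lattice"
  proof cases
    case 1 then show ?thesis using D_lattice_diff by blast
  next
    case 2 then show ?thesis using D_lattice_diff[of "x - h" y] by (simp add: algebra_simps)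
  next
    case 3
    then show ?thesis using D_lattice_diff[OF D_lattice_diff[of x "y - h"] hh] by (simp add: algebra_simps)
  next
    case 4 then show ?thesis using D_lattice_diff[of "x - h" "y - h"] by (simp add: algebra_simps)
  qed
  then show ?thesis by (simp add: D_plus_iff h_def)
qed

lemma signed_perm_Z_lattice:
  assumes "\<And>p. s p \<in> {1, -1}" "x \<in> Z_lattice"
  shows "signed_perm s \<pi> x \<in> Z_lattice"
proof -
  have "s p \<in> \<int>" for p using assms(1)[of p] by auto
  then show ?thesis using assms(2) by (auto simp: Z_lattice_def)
qed

text \<open>A sign change alters an integer coordinate by an even number, so the parity of the sum
  survives.\<close>

lemma signed_perm_D_lattice:
  fixes x :: "real ^ 'n::finite"
  assumes s: "\<And>p. s p \<in> {1, -1}" and "bij \<pi>" and x: "x \<in> D_lattice"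
  shows "signed_perm s \<pi> x \<in> D_lattice"
proof -
  obtain k :: int where k: "(\<Sum>i\<in>UNIV. x $ i) = 2 * of_int k" using x by (auto simp: D_lattice_iff)
  have "\<exists>j::int. s p * x $ \<pi> p = x $ \<pi> p + 2 * of_int j" for p
  proof -
    obtain i :: int where "x $ \<pi> p = of_int i"
      using x by (auto simp: D_lattice_iff Z_lattice_def elim: Ints_cases)
    then have "s p * x $ \<pi> p = x $ \<pi> p + 2 * of_int (if s p = 1 then 0 else - i)"
      using s[of p] by auto
    then show ?thesis by blast
  qed
  then obtain j :: "'n \<Rightarrow> int" where j: "\<And>p. s p * x $ \<pi> p = x $ \<pi> p + 2 * of_int (j p)" by metis
  have "(\<Sum>p\<in>UNIV. signed_perm s \<pi> x $ p) = (\<Sum>p\<in>UNIV. x $ \<pi> p) + 2 * (\<Sum>p\<in>UNIV. of_int (j p))"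
    by (simp add: j sum.distrib sum_distrib_left)
  also have "(\<Sum>p\<in>UNIV. x $ \<pi> p) = 2 * of_int k"
    using sum.reindex_bij_betw[OF assms(2), of "\<lambda>p. x $ p"] k by simp
  finally have "(\<Sum>p\<in>UNIV. signed_perm s \<pi> x $ p) = 2 * of_int (k + (\<Sum>p\<in>UNIV. j p))" by simp
  moreover have "signed_perm s \<pi> x \<in> Z_lattice"
    using x by (intro signed_perm_Z_lattice s) (simp add: D_lattice_iff)
  ultimately show ?thesis unfolding D_lattice_iff by blast
qed

text \<open>Only the image of the glue vector matters. It differs from the glue vector by -1 at the
  places with sign -1, which are half of the 4m coordinates, so the difference \<open>d\<close> has
  the even sum -2m. A single sign change would leave \<open>D_plus\<close>.\<close>

lemma signed_perm_D_plus:
  fixes x :: "real ^ 'n::finite"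
  assumes card: "CARD('n) = 4 * m" and s: "\<And>p. s p \<in> {1, -1}" and bij: "bij \<pi>"
    and twist: "\<And>p. s p * s (\<pi> p) = -1" and x: "x \<in> D_plus"
  shows "signed_perm s \<pi> x \<in> D_plus"
proof -
  let ?h = "(\<chi> i. 1/2) :: real ^ 'n"
  define d where "d = signed_perm s \<pi> ?h - ?h"
  have s': "s (\<pi> p) = - s p" for p using twist[of p] s[of p] by auto
  \<comment> \<open>The twisting condition makes \<open>s\<close> take both signs equally often.\<close>
  have "(\<Sum>p\<in>UNIV. s p) = (\<Sum>p\<in>UNIV. s (\<pi> p))" using sum.reindex_bij_betw[OF bij, of s] by simp
  then have "(\<Sum>p\<in>UNIV. s p) = 0" by (simp add: s' sum_negf)
  then have "(\<Sum>p\<in>UNIV. d $ p) = 2 * of_int (- int m)"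
    by (simp add: d_def sum_subtractf sum_distrib_right[symmetric] card sum_divide_distrib[symmetric])
  moreover have "d $ p \<in> \<int>" for p using s[of p] by (auto simp: d_def)
  ultimately have d: "d \<in> D_lattice" unfolding D_lattice_iff Z_lattice_def by blast
  show ?thesis
  proof (cases "x \<in> D_lattice")
    case True
    then show ?thesis using signed_perm_D_lattice[OF s bij] by (simp add: D_plus_iff)
  next
    case False
    then have "x - ?h \<in> D_lattice" using x by (simp add: D_plus_iff)
    then have "signed_perm s \<pi> (x - ?h) \<in> D_lattice" by (rule signed_perm_D_lattice[OF s bij])
    then have "signed_perm s \<pi> (x - ?h) - (0 - d) \<in> D_lattice"
      using D_lattice_diff d by (metis diff_self)
    also have "signed_perm s \<pi> (x - ?h) - (0 - d) = signed_perm s \<pi> x - ?h"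
      by (simp add: d_def linear_diff[OF linear_signed_perm])
    finally show ?thesis by (simp add: D_plus_iff)
  qed
qed

text \<open>The coordinates are cut into m quadruples, each a copy of Hamilton's quaternions, on
  which two anticommuting units act. A pair of booleans names the four basis elements; each unit
  flips one of them.\<close>

lemma quaternion_signed_perms_exist:
  assumes "CARD('n::finite) = 4 * m"
  obtains s t :: "'n::finite \<Rightarrow> real" and \<pi> \<rho> where "quaternion_signed_perms s t \<pi> \<rho>"
proof -
  have "card (UNIV :: (bool \<times> bool) set) = 4" by (simp add: UNIV_bool card_cartesian_product flip: UNIV_Times_UNIV)
  then have "card (UNIV :: 'n set) = card ((UNIV :: (bool \<times> bool) set) \<times> {..<m})"
    by (simp add: assms card_cartesian_product)
  then obtain h :: "'n \<Rightarrow> (bool \<times> bool) \<times> nat" where h: "bij_betw h UNIV (UNIV \<times> {..<m})"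
    using finite_same_card_bij[of "UNIV :: 'n set" "(UNIV :: (bool \<times> bool) set) \<times> {..<m}"] by auto
  define g where "g = inv_into UNIV h"
  have gh: "g (h p) = p" for p using h unfolding g_def by (simp add: bij_betw_def)
  have hg: "h (g ((a, b), q)) = ((a, b), q)" if "q < m" for a b q
    unfolding g_def using that h by (intro f_inv_into_f) (auto simp: bij_betw_def)
  define s where "s p = (case h p of ((a, b), q) \<Rightarrow> if a then -1 else (1::real))" for p
  define t where "t p = (case h p of ((a, b), q) \<Rightarrow> if a = b then 1 else (-1::real))" for p
  define \<pi> where "\<pi> p = (case h p of ((a, b), q) \<Rightarrow> g ((\<not> a, b), q))" for p
  define \<rho> where "\<rho> p = (case h p of ((a, b), q) \<Rightarrow> g ((a, \<not> b), q))" for p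
  have *: "\<exists>a b q. p = g ((a, b), q) \<and> q < m" for p
  proof -
    obtain a b q where hp: "h p = ((a, b), q)" by (metis prod.exhaust)
    moreover have "h p \<in> UNIV \<times> {..<m}" using bij_betwE[OF h] by blast
    ultimately have "q < m" by auto
    then show ?thesis using gh[of p] unfolding hp by metis
  qed
  have "quaternion_signed_perms s t \<pi> \<rho>"
  proof
    fix p
    obtain a b q where p: "p = g ((a, b), q)" "q < m" using * by metis
    show "s p \<in> {1, -1}" "t p \<in> {1, -1}" "\<pi> (\<pi> p) = p" "\<rho> (\<rho> p) = p" "s p * s (\<pi> p) = -1"
      "t p * t (\<rho> p) = -1" "\<pi> (\<rho> p) = \<rho> (\<pi> p)" "s p * t (\<pi> p) = - (t p * s (\<rho> p))"
      using p(2) by (auto simp: p(1) s_def t_def \<pi>_def \<rho>_def hg)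
  qed
  then show thesis by (rule that)
qed

lemma cubic_multipliers:
  assumes card: "CARD('n::finite) = 4 * m"
  shows "\<exists>\<sigma>. multiplier (real c) (Z_lattice :: (real ^ 'n::finite) set) \<sigma>"
    and "\<exists>\<sigma>. multiplier (real c) (D_lattice :: (real ^ 'n::finite) set) \<sigma>"
    and "\<exists>\<sigma>. multiplier (real c) (D_plus :: (real ^ 'n::finite) set) \<sigma>"
proof -
  obtain s t :: "'n \<Rightarrow> real" and \<pi> \<rho> where "quaternion_signed_perms s t \<pi> \<rho>"
    using quaternion_signed_perms_exist[OF card] .
  then interpret quaternion_signed_perms s t \<pi> \<rho> .
  show "\<exists>\<sigma>. multiplier (real c) (Z_lattice :: (real ^ 'n) set) \<sigma>"
    by (intro multiplier_exists Z_lattice_diff signed_perm_Z_lattice s_sign t_sign)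
  show "\<exists>\<sigma>. multiplier (real c) (D_lattice :: (real ^ 'n) set) \<sigma>"
    by (intro multiplier_exists D_lattice_diff signed_perm_D_lattice s_sign t_sign bij_\<pi> bij_\<rho>)
  show "\<exists>\<sigma>. multiplier (real c) (D_plus :: (real ^ 'n) set) \<sigma>"
    by (intro multiplier_exists D_plus_diff[OF card] signed_perm_D_plus[OF card] s_sign t_sign
      bij_\<pi> bij_\<rho> s_twist t_twist)
qed

section \<open>The Coxeter--Todd lattice\<close>

lemma exhaust_6:
  fixes x :: 6
  shows "x = 1 \<or> x = 2 \<or> x = 3 \<or> x = 4 \<or> x = 5 \<or> x = 6"
proof (induct x)
  case (of_int z)
  then have "z = 0 \<or> z = 1 \<or> z = 2 \<or> z = 3 \<or> z = 4 \<or> z = 5" by fastforce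
  then show ?case by auto
qed

lemma forall_6: "(\<forall>i::6. P i) \<longleftrightarrow> P 1 \<and> P 2 \<and> P 3 \<and> P 4 \<and> P 5 \<and> P 6"
  by (metis exhaust_6)

lemma sum_6: "sum f (UNIV::6 set) = f 1 + f 2 + f 3 + f 4 + f 5 + f 6"
proof -
  have UNIV_6: "(UNIV :: 6 set) = {1, 2, 3, 4, 5, 6}" using exhaust_6 by auto
  show ?thesis unfolding UNIV_6 by (simp add: ac_simps)
qed

lemma vector_6 [simp]:
  "(vector [a, b, c, d, e, f] :: ('a::zero) ^ 6) $ 1 = a"
  "(vector [a, b, c, d, e, f] :: ('a::zero) ^ 6) $ 2 = b"
  "(vector [a, b, c, d, e, f] :: ('a::zero) ^ 6) $ 3 = c"
  "(vector [a, b, c, d, e, f] :: ('a::zero) ^ 6) $ 4 = d"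
  "(vector [a, b, c, d, e, f] :: ('a::zero) ^ 6) $ 5 = e"
  "(vector [a, b, c, d, e, f] :: ('a::zero) ^ 6) $ 6 = f"
  unfolding vector_def by simp_all

lemma \<omega>_square: "\<omega>\<^sup>2 = - 1 - \<omega>"
  by (simp add: \<omega>_def complex_eq_iff cos_120 sin_120 power2_eq_square)

lemma \<omega>_mult_\<omega>: "\<omega> * (\<omega> * z) = - z - \<omega> * z"
proof -
  have "\<omega> * (\<omega> * z) = \<omega>\<^sup>2 * z" by (simp add: power2_eq_square)
  also have "\<dots> = - z - \<omega> * z" unfolding \<omega>_square by (simp add: algebra_simps)
  finally show ?thesis .
qed

lemma cnj_\<omega>: "cnj \<omega> = - 1 - \<omega>"
  by (simp add: \<omega>_def complex_eq_iff cos_120 sin_120)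

lemma Eisenstein_iff: "z \<in> Eisenstein \<longleftrightarrow> (\<exists>a b. z = of_int a + of_int b * \<omega>)"
  by (simp add: Eisenstein_def)

lemma Eisenstein_of_int [simp]: "of_int k \<in> Eisenstein"
  unfolding Eisenstein_iff by (intro exI[of _ k] exI[of _ 0]) simp

lemma Eisenstein_numeral [simp]: "0 \<in> Eisenstein" "1 \<in> Eisenstein" "numeral n \<in> Eisenstein"
  using Eisenstein_of_int[of 0] Eisenstein_of_int[of 1] Eisenstein_of_int[of "numeral n"] by simp_all

lemma Eisenstein_\<omega> [simp]: "\<omega> \<in> Eisenstein"
  unfolding Eisenstein_iff by (intro exI[of _ 0] exI[of _ 1]) simp

lemma Eisenstein_add [simp, intro]:
  assumes "x \<in> Eisenstein" "y \<in> Eisenstein"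
  shows "x + y \<in> Eisenstein"
proof -
  obtain a b c d :: int where "x = of_int a + of_int b * \<omega>" "y = of_int c + of_int d * \<omega>"
    using assms unfolding Eisenstein_iff by metis
  then have "x + y = of_int (a + c) + of_int (b + d) * \<omega>" by (simp add: algebra_simps)
  then show ?thesis unfolding Eisenstein_iff by blast
qed

lemma Eisenstein_mult [simp, intro]:
  assumes "x \<in> Eisenstein" "y \<in> Eisenstein"
  shows "x * y \<in> Eisenstein"
proof -
  obtain a b c d :: int where "x = of_int a + of_int b * \<omega>" "y = of_int c + of_int d * \<omega>"
    using assms unfolding Eisenstein_iff by metis
  then have "x * y = of_int (a*c) + of_int (a*d + b*c) * \<omega> + of_int (b*d) * \<omega>\<^sup>2"
    by (simp add: algebra_simps power2_eq_square)
  then have "x * y = of_int (a*c - b*d) + of_int (a*d + b*c - b*d) * \<omega>"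
    by (simp add: algebra_simps \<omega>_square)
  then show ?thesis unfolding Eisenstein_iff by blast
qed

lemma Eisenstein_uminus [simp, intro]: "x \<in> Eisenstein \<Longrightarrow> - x \<in> Eisenstein"
  using Eisenstein_mult[OF Eisenstein_of_int[of "-1"]] by simp

lemma Eisenstein_diff [simp, intro]: "x \<in> Eisenstein \<Longrightarrow> y \<in> Eisenstein \<Longrightarrow> x - y \<in> Eisenstein"
  using Eisenstein_add[OF _ Eisenstein_uminus] by fastforce

lemma Eisenstein_cnj [simp, intro]:
  assumes "x \<in> Eisenstein"
  shows "cnj x \<in> Eisenstein"
proof -
  obtain a b :: int where "x = of_int a + of_int b * \<omega>" using assms unfolding Eisenstein_iff by metis
  then have "cnj x = of_int a + of_int b * (- 1 - \<omega>)" by (simp add: cnj_\<omega>)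
  then show ?thesis by (metis Eisenstein_add Eisenstein_mult Eisenstein_of_int Eisenstein_\<omega>
      Eisenstein_diff of_int_minus of_int_1)
qed

lemma Eisenstein_\<omega>_square [simp]: "\<omega>\<^sup>2 \<in> Eisenstein"
  by (simp add: power2_eq_square)

definition even_Eisenstein :: "complex set" where
  "even_Eisenstein = (*) 2 ` Eisenstein"

lemma even_Eisenstein_cases:
  assumes "z \<in> even_Eisenstein" obtains w where "w \<in> Eisenstein" "z = 2 * w"
  using assms by (auto simp: even_Eisenstein_def)

lemma even_EisensteinI: "w \<in> Eisenstein \<Longrightarrow> z = 2 * w \<Longrightarrow> z \<in> even_Eisenstein"
  by (simp add: even_Eisenstein_def)

lemma even_Eisenstein_diff: "x \<in> even_Eisenstein \<Longrightarrow> y \<in> even_Eisenstein \<Longrightarrow> x - y \<in> even_Eisenstein"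
  by (elim even_Eisenstein_cases, rule even_EisensteinI[OF Eisenstein_diff]) auto

lemma even_Eisenstein_mult: "x \<in> Eisenstein \<Longrightarrow> y \<in> even_Eisenstein \<Longrightarrow> x * y \<in> even_Eisenstein"
  by (elim even_Eisenstein_cases, rule even_EisensteinI[OF Eisenstein_mult]) auto

text \<open>The first three coordinates are information positions of the hexacode: they are
  arbitrary and determine the other three modulo 2.\<close>

lemma K12_lattice_iff:
  "x \<in> K12_lattice \<longleftrightarrow> x$1 \<in> Eisenstein \<and> x$2 \<in> Eisenstein \<and> x$3 \<in> Eisenstein \<and>
     x$4 - (x$1 + x$2 + x$3) \<in> even_Eisenstein \<and>
     x$5 - (x$1 * \<omega>\<^sup>2 + x$2 * \<omega> + x$3) \<in> even_Eisenstein \<and>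
     x$6 - (x$1 * \<omega> + x$2 * \<omega>\<^sup>2 + x$3) \<in> even_Eisenstein" (is "_ \<longleftrightarrow> ?R")
proof
  assume "x \<in> K12_lattice"
  then obtain a b c y where E: "a \<in> Eisenstein" "b \<in> Eisenstein" "c \<in> Eisenstein"
      "\<forall>i. y $ i \<in> Eisenstein"
    and x: "x = vector [a, b, c, a + b + c, a * \<omega>^2 + b * \<omega> + c, a * \<omega> + b * \<omega>^2 + c] + 2 *s y"
    unfolding K12_lattice_def by blast
  have "x$1 \<in> Eisenstein" "x$2 \<in> Eisenstein" "x$3 \<in> Eisenstein" using E by (simp_all add: x)
  moreover have "x$4 - (x$1 + x$2 + x$3) = 2 * (y$4 - y$1 - y$2 - y$3)"
    "x$5 - (x$1 * \<omega>\<^sup>2 + x$2 * \<omega> + x$3) = 2 * (y$5 - y$1 * \<omega>\<^sup>2 - y$2 * \<omega> - y$3)"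
    "x$6 - (x$1 * \<omega> + x$2 * \<omega>\<^sup>2 + x$3) = 2 * (y$6 - y$1 * \<omega> - y$2 * \<omega>\<^sup>2 - y$3)"
    by (simp_all add: x algebra_simps)
  moreover have "y$4 - y$1 - y$2 - y$3 \<in> Eisenstein"
    "y$5 - y$1 * \<omega>\<^sup>2 - y$2 * \<omega> - y$3 \<in> Eisenstein"
    "y$6 - y$1 * \<omega> - y$2 * \<omega>\<^sup>2 - y$3 \<in> Eisenstein"
    using E(4) by simp_all
  ultimately show ?R by (metis even_EisensteinI)
next
  assume ?R
  then obtain d e f where def: "d \<in> Eisenstein" "x$4 - (x$1 + x$2 + x$3) = 2 * d"
    "e \<in> Eisenstein" "x$5 - (x$1 * \<omega>\<^sup>2 + x$2 * \<omega> + x$3) = 2 * e"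
    "f \<in> Eisenstein" "x$6 - (x$1 * \<omega> + x$2 * \<omega>\<^sup>2 + x$3) = 2 * f"
    by (metis even_Eisenstein_cases)
  \<comment> \<open>Since \<open>a\<close>, \<open>b\<close>, \<open>c\<close> can be taken to be
    the first three coordinates themselves, the correction by even vectors is needed only in the
    last three.\<close>
  let ?y = "vector [0, 0, 0, d, e, f] :: complex ^ 6"
  have "\<forall>i. ?y $ i \<in> Eisenstein" using def by (simp add: forall_6)
  moreover have "x = vector [x$1, x$2, x$3, x$1 + x$2 + x$3, x$1 * \<omega>^2 + x$2 * \<omega> + x$3,
      x$1 * \<omega> + x$2 * \<omega>^2 + x$3] + 2 *s ?y"
    using def by (simp add: vec_eq_iff forall_6 algebra_simps)
  ultimately show "x \<in> K12_lattice" using \<open>?R\<close> unfolding K12_lattice_def by blast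
qed

lemma K12_lattice_diff: 
  assumes "x \<in> K12_lattice" "y \<in> K12_lattice"
  shows "x - y \<in> K12_lattice"
proof -
  have *: "(x - y)$4 - ((x - y)$1 + (x - y)$2 + (x - y)$3) =
      x$4 - (x$1 + x$2 + x$3) - (y$4 - (y$1 + y$2 + y$3))"
    "(x - y)$5 - ((x - y)$1 * \<omega>\<^sup>2 + (x - y)$2 * \<omega> + (x - y)$3) =
      x$5 - (x$1 * \<omega>\<^sup>2 + x$2 * \<omega> + x$3) - (y$5 - (y$1 * \<omega>\<^sup>2 + y$2 * \<omega> + y$3))"
    "(x - y)$6 - ((x - y)$1 * \<omega> + (x - y)$2 * \<omega>\<^sup>2 + (x - y)$3) =
      x$6 - (x$1 * \<omega> + x$2 * \<omega>\<^sup>2 + x$3) - (y$6 - (y$1 * \<omega> + y$2 * \<omega>\<^sup>2 + y$3))"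
    by (simp_all add: algebra_simps)
  show ?thesis using assms unfolding K12_lattice_iff *
    by (simp add: even_Eisenstein_diff)
qed

lemma K12_lattice_scale:
  assumes "x \<in> K12_lattice" "z \<in> Eisenstein"
  shows "z *s x \<in> K12_lattice"
proof -
  have *: "(z *s x)$4 - ((z *s x)$1 + (z *s x)$2 + (z *s x)$3) = z * (x$4 - (x$1 + x$2 + x$3))"
    "(z *s x)$5 - ((z *s x)$1 * \<omega>\<^sup>2 + (z *s x)$2 * \<omega> + (z *s x)$3) =
      z * (x$5 - (x$1 * \<omega>\<^sup>2 + x$2 * \<omega> + x$3))"
    "(z *s x)$6 - ((z *s x)$1 * \<omega> + (z *s x)$2 * \<omega>\<^sup>2 + (z *s x)$3) =
      z * (x$6 - (x$1 * \<omega> + x$2 * \<omega>\<^sup>2 + x$3))"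
    by (simp_all add: algebra_simps)
  show ?thesis using assms unfolding K12_lattice_iff *
    by (simp add: even_Eisenstein_mult)
qed

text \<open>Modulo 2 this is a semilinear automorphism of the hexacode that pairs off the coordinates; the
  signs make its square \<open>-1\<close>.\<close>

definition K12_conj :: "complex ^ 6 \<Rightarrow> complex ^ 6" where
  "K12_conj x = vector [cnj (x$2), - cnj (x$1), cnj (x$4), - cnj (x$3), cnj (x$6), - cnj (x$5)]"

lemma K12_lattice_conj:
  assumes "x \<in> K12_lattice"
  shows "K12_conj x \<in> K12_lattice"
proof -
  from assms obtain d e f where E: "x$1 \<in> Eisenstein" "x$2 \<in> Eisenstein" "x$3 \<in> Eisenstein"
    "d \<in> Eisenstein" "e \<in> Eisenstein" "f \<in> Eisenstein" and def: "x$4 - (x$1 + x$2 + x$3) = 2 * d"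
    "x$5 - (x$1 * \<omega>\<^sup>2 + x$2 * \<omega> + x$3) = 2 * e"
    "x$6 - (x$1 * \<omega> + x$2 * \<omega>\<^sup>2 + x$3) = 2 * f"
    unfolding K12_lattice_iff by (metis even_Eisenstein_cases)
  have x: "x$4 = x$1 + x$2 + x$3 + 2 * d" "x$5 = x$1 * (-1 - \<omega>) + x$2 * \<omega> + x$3 + 2 * e"
    "x$6 = x$1 * \<omega> + x$2 * (-1 - \<omega>) + x$3 + 2 * f"
    using def by (simp_all add: \<omega>_square algebra_simps)
  let ?u = "K12_conj x"
  \<comment> \<open>The halves arise by substituting \<open>x\<close>, pulling conjugation outside
    (it exchanges \<omega> and its square) and collecting terms with 1 + \<omega> + \<omega>^2 =
    0.\<close>
  have "?u$4 - (?u$1 + ?u$2 + ?u$3) = 2 * cnj (- d - x$2 - x$3)"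
    "?u$5 - (?u$1 * \<omega>\<^sup>2 + ?u$2 * \<omega> + ?u$3) = 2 * cnj (f - d - x$1 + x$2 * (-1 - \<omega>))"
    "?u$6 - (?u$1 * \<omega> + ?u$2 * \<omega>\<^sup>2 + ?u$3) = 2 * cnj (x$1 * \<omega> - x$3 - e - d)"
    by (simp_all add: K12_conj_def x cnj_\<omega> \<omega>_square algebra_simps \<omega>_mult_\<omega>)
  moreover have "?u$1 \<in> Eisenstein" "?u$2 \<in> Eisenstein" "?u$3 \<in> Eisenstein"
    using E by (auto simp: K12_conj_def x(1))
  moreover have "cnj (- d - x$2 - x$3) \<in> Eisenstein"
    "cnj (f - d - x$1 + x$2 * (-1 - \<omega>)) \<in> Eisenstein"
    "cnj (x$1 * \<omega> - x$3 - e - d) \<in> Eisenstein"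
    using E by (intro Eisenstein_cnj; simp)+
  ultimately show ?thesis unfolding K12_lattice_iff by (metis even_EisensteinI)
qed

text \<open>Conjugate-linearity of \<open>K12_conj\<close> gives J T = cnj (1 + \<omega>) J, and the
  conjugate of 1 + \<omega> is 1 - (1 + \<omega>), which is the required relation for
  \<open>e = 1\<close>.\<close>

lemma K12_multiplier: "\<exists>\<sigma>. multiplier (real c) K12_lattice \<sigma>"
proof (rule multiplier_of_quaternion_action[where e = 1 and T = "\<lambda>u. (1 + \<omega>) *s u" and J = K12_conj])
  show "linear (\<lambda>u :: complex ^ 6. (1 + \<omega>) *s u)"
    by (rule linearI) (simp_all add: vec_eq_iff algebra_simps)
  show "linear K12_conj"
    by (rule linearI) (simp_all add: K12_conj_def vec_eq_iff forall_6)
  have norm: "(Re (1 + \<omega>))\<^sup>2 + (Im (1 + \<omega>))\<^sup>2 = 1"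
    by (simp add: \<omega>_def cos_120 sin_120 power2_eq_square)
  have "((1 + \<omega>) * a) \<bullet> ((1 + \<omega>) * b) = a \<bullet> b" for a b
  proof -
    have "((1 + \<omega>) * a) \<bullet> ((1 + \<omega>) * b) = ((Re (1 + \<omega>))\<^sup>2 + (Im (1 + \<omega>))\<^sup>2) * (a \<bullet> b)"
      unfolding inner_complex_def times_complex.sel by algebra
    then show ?thesis by (simp only: norm mult_1)
  qed
  then show "((1 + \<omega>) *s u) \<bullet> ((1 + \<omega>) *s v) = u \<bullet> v" for u v :: "complex ^ 6"
    by (simp only: inner_vec_def vector_smult_component)
  show "K12_conj u \<bullet> K12_conj v = u \<bullet> v" for u v
    by (simp add: inner_vec_def sum_6 K12_conj_def inner_complex_def)
  show "(1 + \<omega>) *s ((1 + \<omega>) *s u) = of_int 1 *\<^sub>R ((1 + \<omega>) *s u) - u" for u :: "complex ^ 6"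
    by (simp add: vec_eq_iff algebra_simps \<omega>_mult_\<omega>)
  show "K12_conj (K12_conj u) = - u" for u
    by (simp add: K12_conj_def vec_eq_iff forall_6)
  show "K12_conj ((1 + \<omega>) *s u) = of_int 1 *\<^sub>R K12_conj u - (1 + \<omega>) *s K12_conj u" for u
    by (simp add: K12_conj_def vec_eq_iff forall_6 cnj_\<omega> algebra_simps)
  show "(1 + \<omega>) *s u \<in> K12_lattice" if "u \<in> K12_lattice" for u
    using that by (intro K12_lattice_scale) auto
qed (simp_all add: K12_lattice_diff K12_lattice_conj)

section \<open>The Barnes--Wall lattice\<close>

text \<open>These rewrite the ring operations of \<^typ>\<open>bit\<close> into bitwise ones, out of reach of the ring laws.\<close>

declare add_bit_eq_xor [simp del] mult_bit_eq_and [simp del]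

lemma bit_add_self [simp]: "b + b = (0 :: bit)"
  by (cases b) simp_all

lemma bit_add_self_left [simp]: "b + (b + c) = (c :: bit)"
  by (simp add: add.assoc[symmetric])

lemma of_int_bit_eq_0_iff: "(of_int k :: bit) = 0 \<longleftrightarrow> even k"
proof -
  have *: "(of_int (2 * j) :: bit) = 0" for j by simp
  show ?thesis
  proof (cases "even k")
    case True
    then show ?thesis using * by (auto elim!: evenE)
  next
    case False
    then obtain j where "k = 2 * j + 1" by (elim oddE)
    then have "(of_int k :: bit) = of_int (2 * j) + 1" by (simp del: of_int_mult)
    then show ?thesis using False * by simp
  qed
qed

text \<open>The two hyperplanes given by coordinate \<open>k\<close> contribute equal sums, which
  cancel in characteristic 2.\<close>

lemma sum_translation_invariant_bit:
  fixes f :: "bit ^ 'n::finite \<Rightarrow> bit"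
  assumes inv: "\<And>v. f (v + axis k 1) = f v"
  shows "sum f UNIV = 0"
proof -
  define A where "A = {v :: bit ^ 'n. v $ k = 0}"
  define B where "B = {v :: bit ^ 'n. v $ k = 1}"
  have U: "UNIV = A \<union> B" "A \<inter> B = {}" by (auto simp: A_def B_def)
  have twice: "v + axis k 1 + axis k 1 = v" for v :: "bit ^ 'n"
    by (simp add: vec_eq_iff add.assoc)
  have "sum f B = sum f A"
  proof (rule sum.reindex_bij_witness[of _ "\<lambda>v. v + axis k 1" "\<lambda>v. v + axis k 1"])
  qed (auto simp: A_def B_def twice inv)
  moreover have "sum f UNIV = sum f A + sum f B"
    unfolding U(1) by (rule sum.union_disjoint) (use U(2) in auto)
  ultimately show ?thesis by simp
qed

text \<open>A product of two coordinates does not involve some third one, and translations along that one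
  pair off its values.\<close>

lemma affine_orthogonal_linear:
  fixes l m :: "bit ^ 4"
  shows "(\<Sum>v\<in>UNIV. (\<Sum>i\<in>UNIV. l $ i * v $ i) * (b + (\<Sum>j\<in>UNIV. m $ j * v $ j))) = 0"
proof -
  have quad: "(\<Sum>v\<in>UNIV. v $ i * v $ j) = (0 :: bit)" for i j :: 4
  proof -
    have "card {i, j} < card (UNIV :: 4 set)" by (cases "i = j") simp_all
    then have "{i, j} \<noteq> UNIV" by (metis less_irrefl)
    then obtain k where "k \<noteq> i" "k \<noteq> j" by auto
    then show ?thesis by (intro sum_translation_invariant_bit[of _ k]) (simp add: axis_def)
  qed
  have idem: "x * x = x" for x :: bit by (cases x) simp_all
  have lin: "(\<Sum>v\<in>UNIV. v $ i) = (0 :: bit)" for i :: 4 using quad[of i i] by (simp add: idem)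
  have "(\<Sum>v\<in>UNIV. (\<Sum>i\<in>UNIV. l $ i * v $ i) * (b + (\<Sum>j\<in>UNIV. m $ j * v $ j))) =
    (\<Sum>v\<in>UNIV. \<Sum>i\<in>UNIV. l $ i * b * v $ i) + (\<Sum>v\<in>UNIV. \<Sum>i\<in>UNIV. \<Sum>j\<in>UNIV. l $ i * m $ j * (v $ i * v $ j))"
    unfolding distrib_left sum_product sum.distrib unfolding sum_distrib_right by (simp add: ac_simps)
  also have "(\<Sum>v\<in>UNIV. \<Sum>i\<in>UNIV. l $ i * b * v $ i) = (\<Sum>i\<in>UNIV. l $ i * b * (\<Sum>v\<in>UNIV. v $ i))"
    by (subst sum.swap) (simp add: sum_distrib_left)
  also have "(\<Sum>v\<in>UNIV. \<Sum>i\<in>UNIV. \<Sum>j\<in>UNIV. l $ i * m $ j * (v $ i * v $ j)) =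
      (\<Sum>i\<in>UNIV. \<Sum>v\<in>UNIV. \<Sum>j\<in>UNIV. l $ i * m $ j * (v $ i * v $ j))" by (rule sum.swap)
  also have "\<dots> = (\<Sum>i\<in>UNIV. \<Sum>j\<in>UNIV. l $ i * m $ j * (\<Sum>v\<in>UNIV. v $ i * v $ j))"
    by (intro sum.cong refl, subst sum.swap) (simp add: sum_distrib_left)
  finally show ?thesis by (simp add: lin quad)
qed

lemma reed_muller_iff: "w \<in> reed_muller \<longleftrightarrow> (\<exists>a b. \<forall>v. w $ v = b + (\<Sum>i\<in>UNIV. a $ i * v $ i))"
  by (auto simp: reed_muller_def vec_eq_iff)

lemma reed_muller_diff:
  assumes "w \<in> reed_muller" "w' \<in> reed_muller"
  shows "w - w' \<in> reed_muller"
proof -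
  obtain a b a' b' where "\<And>v. w $ v = b + (\<Sum>i\<in>UNIV. a $ i * v $ i)"
    "\<And>v. w' $ v = b' + (\<Sum>i\<in>UNIV. a' $ i * v $ i)"
    using assms unfolding reed_muller_iff by metis
  then have "(w - w') $ v = (b - b') + (\<Sum>i\<in>UNIV. (a - a') $ i * v $ i)" for v
    by (simp add: left_diff_distrib sum_subtractf del: minus_bit_def)
  then show ?thesis unfolding reed_muller_iff by blast
qed

lemma BW16_lattice_iff:
  "x \<in> BW16_lattice \<longleftrightarrow> (\<exists>z :: int ^ (bit ^ 4). x = (\<chi> v. of_int (z $ v) / sqrt 2) \<and>
     (\<chi> v. of_int (z $ v)) \<in> reed_muller \<and> [(\<Sum>v\<in>UNIV. z $ v) = 0] (mod 4))"
  unfolding BW16_lattice_def by blast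

lemma BW16_lattice_diff:
  assumes "x \<in> BW16_lattice" "y \<in> BW16_lattice"
  shows "x - y \<in> BW16_lattice"
proof -
  obtain z w :: "int ^ (bit ^ 4)" where x: "x = (\<chi> v. of_int (z $ v) / sqrt 2)"
      and z: "(\<chi> v. of_int (z $ v)) \<in> reed_muller" "[(\<Sum>v\<in>UNIV. z $ v) = 0] (mod 4)"
      and y: "y = (\<chi> v. of_int (w $ v) / sqrt 2)"
      and w: "(\<chi> v. of_int (w $ v)) \<in> reed_muller" "[(\<Sum>v\<in>UNIV. w $ v) = 0] (mod 4)"
    using assms unfolding BW16_lattice_iff by metis
  have "x - y = (\<chi> v. of_int ((z - w) $ v) / sqrt 2)"
    unfolding x y by (simp add: vec_eq_iff diff_divide_distrib)
  moreover have "(\<chi> v. of_int ((z - w) $ v)) = (\<chi> v. of_int (z $ v)) - (\<chi> v. (of_int (w $ v) :: bit))"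
    by (simp add: vec_eq_iff)
  then have "(\<chi> v. of_int ((z - w) $ v)) \<in> reed_muller"
    using reed_muller_diff[OF z(1) w(1)] by simp
  moreover have "[(\<Sum>v\<in>UNIV. (z - w) $ v) = 0] (mod 4)"
    using cong_diff[OF z(2) w(2)] by (simp add: sum_subtractf)
  ultimately show ?thesis unfolding BW16_lattice_iff by blast
qed

text \<open>Translation by \<open>a\<close> changes only the constant term of an affine function,
  and signs are invisible modulo 2, so the code condition persists. The signs change the coordinate
  sum by \<open>2 * E\<close>, where \<open>E\<close> modulo 2 is the inner product of two
  Reed-Muller words and hence zero.\<close>

lemma BW16_lattice_signed_perm:
  fixes l a :: "bit ^ 4"
  assumes x: "x \<in> BW16_lattice"
  shows "signed_perm (\<lambda>v. if (\<Sum>i\<in>UNIV. l $ i * v $ i) = 0 then 1 else -1) (\<lambda>v. v + a) x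
    \<in> BW16_lattice"
proof -
  define S where "S v = (\<Sum>i\<in>UNIV. l $ i * v $ i)" for v
  obtain z :: "int ^ (bit ^ 4)" where x: "x = (\<chi> v. of_int (z $ v) / sqrt 2)"
      and z: "(\<chi> v. of_int (z $ v)) \<in> reed_muller" "[(\<Sum>v\<in>UNIV. z $ v) = 0] (mod 4)"
    using assms unfolding BW16_lattice_iff by metis
  obtain b m where bm: "\<And>v. (of_int (z $ v) :: bit) = b + (\<Sum>i\<in>UNIV. m $ i * v $ i)"
    using z(1) unfolding reed_muller_iff by auto
  define b' where "b' = b + (\<Sum>i\<in>UNIV. m $ i * a $ i)"
  have b': "(of_int (z $ (v + a)) :: bit) = b' + (\<Sum>i\<in>UNIV. m $ i * v $ i)" for v
    by (simp add: bm b'_def distrib_left sum.distrib add.assoc)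
  define y where "y = (\<chi> v. (if S v = 0 then 1 else -1) * z $ (v + a))"
  have "(of_int (y $ v) :: bit) = of_int (z $ (v + a))" for v
    by (simp add: y_def)
  then have "(\<chi> v. of_int (y $ v)) \<in> reed_muller" by (auto simp: reed_muller_iff b')
  moreover have "[(\<Sum>v\<in>UNIV. y $ v) = 0] (mod 4)"
  proof -
    define E where "E = (\<Sum>v\<in>UNIV. if S v = 0 then 0 else z $ (v + a))"
    have "(of_int E :: bit) = (\<Sum>v\<in>UNIV. S v * (b' + (\<Sum>i\<in>UNIV. m $ i * v $ i)))"
      unfolding E_def of_int_sum by (intro sum.cong) (auto simp: b'[symmetric])
    also have "\<dots> = 0" unfolding S_def by (rule affine_orthogonal_linear)
    finally have "even E" by (simp only: of_int_bit_eq_0_iff)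
    then have "[2 * E = 0] (mod 4)" by (auto simp: cong_0_iff elim!: evenE)
    have bij: "bij (\<lambda>v. v + a)" 
      by (rule o_bij[of "\<lambda>v. v + a"]) (simp_all add: fun_eq_iff vec_eq_iff add.assoc)
    have "(\<Sum>v\<in>UNIV. y $ v) = (\<Sum>v\<in>UNIV. z $ (v + a) - 2 * (if S v = 0 then 0 else z $ (v + a)))"
      by (intro sum.cong) (auto simp: y_def)
    also have "\<dots> = (\<Sum>v\<in>UNIV. z $ (v + a)) - 2 * E"
      by (simp add: E_def sum_subtractf sum_distrib_left)
    also have "(\<Sum>v\<in>UNIV. z $ (v + a)) = (\<Sum>v\<in>UNIV. z $ v)"
      using sum.reindex_bij_betw[OF bij] .
    finally show ?thesis using cong_diff[OF z(2) \<open>[2 * E = 0] (mod 4)\<close>] by simp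
  qed
  moreover have "signed_perm (\<lambda>v. if S v = 0 then 1 else -1) (\<lambda>v. v + a) x = (\<chi> v. of_int (y $ v) / sqrt 2)"
    by (simp add: vec_eq_iff x y_def)
  ultimately show ?thesis unfolding BW16_lattice_iff S_def by blast
qed

text \<open>Sign by a functional l followed by translation by a is a Pauli operator: its square is
  (-1)^(l.a), and two of them anticommute exactly when l.a' + l'.a = 1. The pairs l = a = e1 and l'
  = e1 + e2, a' = e2 meet all three requirements.\<close>

lemma BW16_multiplier: "\<exists>\<sigma>. multiplier (real c) BW16_lattice \<sigma>"
proof -
  define s :: "bit ^ 4 \<Rightarrow> real" where
    "s v = (if (\<Sum>i\<in>UNIV. (axis 1 1 :: bit ^ 4) $ i * v $ i) = 0 then 1 else -1)" for v
  define t :: "bit ^ 4 \<Rightarrow> real" where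
    "t v = (if (\<Sum>i\<in>UNIV. (axis 1 1 + axis 2 1 :: bit ^ 4) $ i * v $ i) = 0 then 1 else -1)" for v
  have st: "s v = (if v$1 = 0 then 1 else -1)" "t v = (if v$1 + v$2 = 0 then 1 else -1)" for v
    by (simp_all add: s_def t_def sum_4 axis_def)
  interpret quaternion_signed_perms s t "\<lambda>v. v + axis 1 1" "\<lambda>v. v + axis 2 1"
  proof
    fix v :: "bit ^ 4"
    show "v + axis 1 1 + axis 1 1 = v" "v + axis 2 1 + axis 2 1 = v"
      "v + axis 2 1 + axis 1 1 = v + axis 1 1 + axis 2 1"
      by (simp_all add: vec_eq_iff add.assoc)
    show "s v \<in> {1, -1}" "t v \<in> {1, -1}" by (simp_all add: st)
    show "s v * s (v + axis 1 1) = -1" "t v * t (v + axis 2 1) = -1"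
      "s v * t (v + axis 1 1) = - (t v * s (v + axis 2 1))"
      by (cases "v$1"; cases "v$2"; simp add: st axis_def)+
  qed
  show ?thesis
    by (intro multiplier_exists BW16_lattice_diff)
      (simp_all only: s_def[abs_def] t_def[abs_def] BW16_lattice_signed_perm)
qed

section \<open>The Leech lattice\<close>

lemma exhaust_23:
  fixes x :: 23
  obtains k where "k < 23" "x = of_nat k"
proof (cases x)
  case (of_int z)
  then show thesis using that[of "nat z"] by simp
qed

lemma nat_less_23:
  fixes P :: "nat \<Rightarrow> bool"
  shows "(\<forall>k<23. P k) \<longleftrightarrow> P 0 \<and> P 1 \<and> P 2 \<and> P 3 \<and> P 4 \<and> P 5 \<and> P 6 \<and> P 7 \<and> P 8 \<and> P 9 \<and> P 10 \<and> P 11 \<and> 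
    P 12 \<and> P 13 \<and> P 14 \<and> P 15 \<and> P 16 \<and> P 17 \<and> P 18 \<and> P 19 \<and> P 20 \<and> P 21 \<and> P 22"
  by (simp add: numeral_eq_Suc All_less_Suc2 All_less_Suc)

lemma forall_23:
  "(\<forall>x::23. P x) \<longleftrightarrow> P 0 \<and> P 1 \<and> P 2 \<and> P 3 \<and> P 4 \<and> P 5 \<and> P 6 \<and> P 7 \<and> P 8 \<and> P 9 \<and> P 10 \<and> P 11 \<and> 
    P 12 \<and> P 13 \<and> P 14 \<and> P 15 \<and> P 16 \<and> P 17 \<and> P 18 \<and> P 19 \<and> P 20 \<and> P 21 \<and> P 22"
proof -
  have "(\<forall>x::23. P x) \<longleftrightarrow> (\<forall>k<23. P (of_nat k))" by (metis exhaust_23)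
  then show ?thesis unfolding nat_less_23 by simp
qed

lemma forall_23_option:
  "(\<forall>p. P p) \<longleftrightarrow> P None \<and> P (Some (0::23)) \<and> P (Some (1::23)) \<and> P (Some (2::23)) \<and> P (Some (3::23)) \<and> P (Some (4::23)) \<and> P (Some (5::23)) \<and> P (Some (6::23)) \<and> P (Some (7::23)) \<and> 
    P (Some (8::23)) \<and> P (Some (9::23)) \<and> P (Some (10::23)) \<and> P (Some (11::23)) \<and> P (Some (12::23)) \<and> P (Some (13::23)) \<and> P (Some (14::23)) \<and> P (Some (15::23)) \<and> 
    P (Some (16::23)) \<and> P (Some (17::23)) \<and> P (Some (18::23)) \<and> P (Some (19::23)) \<and> P (Some (20::23)) \<and> P (Some (21::23)) \<and> P (Some (22::23))"
  using forall_23[of "\<lambda>x. P (Some x)"] by (auto simp: split_option_all)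

lemma sum_23:
  fixes f :: "23 \<Rightarrow> 'a::comm_monoid_add"
  shows "sum f UNIV = f 0 + f 1 + f 2 + f 3 + f 4 + f 5 + f 6 + f 7 + f 8 + f 9 + f 10 + f 11 + 
    f 12 + f 13 + f 14 + f 15 + f 16 + f 17 + f 18 + f 19 + f 20 + f 21 + f 22"
proof -
  have UNIV_23: "(UNIV :: 23 set) = {0, 1, 2, 3, 4, 5, 6, 7, 8, 9, 10, 11, 12, 13, 14, 15, 16, 17, 18, 19, 20, 21, 22}"
    using forall_23[of "\<lambda>x. x \<in> {0, 1, 2, 3, 4, 5, 6, 7, 8, 9, 10, 11, 12, 13, 14, 15, 16, 17, 18, 19, 20, 21, 22}"] by auto
  show ?thesis unfolding UNIV_23 by (simp add: ac_simps)
qed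

section \<open>Quadratic residues modulo 23\<close>

definition square23 :: "23 \<Rightarrow> bool" where
  "square23 x \<longleftrightarrow> (\<exists>r. r \<noteq> 0 \<and> x = r\<^sup>2)"

text \<open>A finite check; reciprocals, absence of zero divisors and the quadratic character below
  all derive from it.\<close>

lemma power_11_cases:
  fixes x :: 23
  assumes "x \<noteq> 0"
  shows "x ^ 11 = 1 \<or> x ^ 11 = -1"
proof -
  have "\<forall>x::23. x \<noteq> 0 \<longrightarrow> x ^ 11 = 1 \<or> x ^ 11 = -1" unfolding forall_23 by simp
  then show ?thesis using assms by blast
qed

lemma power_22:
  fixes x :: 23
  assumes "x \<noteq> 0"
  shows "x ^ 22 = 1"
proof -
  have "x ^ 22 = (x ^ 11)\<^sup>2" by (simp flip: power_mult)
  also have "\<dots> = 1" using power_11_cases[OF assms] by (metis one_power2 power2_minus)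
  finally show ?thesis .
qed

lemma mult_power_21:
  fixes x :: 23
  assumes "x \<noteq> 0"
  shows "x * x ^ 21 = 1"
  using power_22[OF assms] power_Suc[of x 21] by simp

text \<open>Euler's criterion. Conversely, x^11 = 1 gives x = x^12 = (x^6)^2, an explicit
  root.\<close>

lemma square23_iff: "square23 x \<longleftrightarrow> x ^ 11 = 1"
proof
  assume "square23 x"
  then obtain r where r: "r \<noteq> 0" "x = r\<^sup>2" unfolding square23_def by blast
  have "x ^ 11 = r ^ 22" unfolding r(2) by (simp flip: power_mult)
  then show "x ^ 11 = 1" using power_22[OF r(1)] by simp
next
  assume x: "x ^ 11 = 1"
  have "x ^ 6 \<noteq> 0"
  proof
    assume "x ^ 6 = 0"
    then have "x ^ 6 * x ^ 5 = 0" by simp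
    then show False using x by (simp flip: power_add)
  qed
  moreover have "x = (x ^ 6)\<^sup>2" using x power_Suc[of x 11] by (simp flip: power_mult)
  ultimately show "square23 x" unfolding square23_def by blast
qed

lemma mult_23_eq_0_iff: "x * y = 0 \<longleftrightarrow> x = 0 \<or> y = (0 :: 23)"
proof
  assume xy: "x * y = 0"
  show "x = 0 \<or> y = 0"
  proof (rule ccontr)
    assume *: "\<not> (x = 0 \<or> y = 0)"
    have "x ^ 21 * (x * y) = (x * x ^ 21) * y" by (simp only: ac_simps)
    then show False using * xy mult_power_21[of x] by simp
  qed
qed auto

lemma square23_mult:
  assumes "x \<noteq> 0" "y \<noteq> 0"
  shows "square23 (x * y) \<longleftrightarrow> (square23 x \<longleftrightarrow> square23 y)"
  using power_11_cases[OF assms(1)] power_11_cases[OF assms(2)]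
  by (auto simp: square23_iff power_mult_distrib)

lemma square23_0 [simp]: "\<not> square23 0"
  by (simp add: square23_iff)

text \<open>The exponent 11 is odd, so negation changes the sign of \<open>x ^ 11\<close>;
  equivalently 23 is 3 modulo 4.\<close>

lemma square23_minus: "x \<noteq> 0 \<Longrightarrow> square23 (- x) \<longleftrightarrow> \<not> square23 x"
  using power_11_cases[of x] by (auto simp: square23_iff)

section \<open>The Golay code and its automorphisms\<close>

definition golay_gen :: "23 \<Rightarrow> bit ^ (23 option)" where
  "golay_gen i = (\<chi> p. case p of None \<Rightarrow> 1 | Some j \<Rightarrow> of_bool (square23 (j - i)))"

lemma golay_gen_None [simp]: "golay_gen i $ None = 1"
  and golay_gen_Some: "golay_gen i $ Some j = of_bool (square23 (j - i))"
  by (simp_all add: golay_gen_def)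

lemma golay_code_eq: "golay_code = vec.span (range golay_gen)"
  unfolding golay_code_def golay_gen_def square23_def ..

lemma golay_gen_in [simp]: "golay_gen i \<in> golay_code"
  unfolding golay_code_eq by (intro vec.span_base) simp

lemma golay_zero [simp]: "0 \<in> golay_code"
  unfolding golay_code_eq by (rule vec.span_zero)

lemma golay_add: "x \<in> golay_code \<Longrightarrow> y \<in> golay_code \<Longrightarrow> x + y \<in> golay_code"
  unfolding golay_code_eq by (rule vec.span_add)

lemma golay_scale: "x \<in> golay_code \<Longrightarrow> b *s x \<in> golay_code"
  unfolding golay_code_eq by (rule vec.span_scale)

lemma golay_diff: "x \<in> golay_code \<Longrightarrow> y \<in> golay_code \<Longrightarrow> x - y \<in> golay_code"
  unfolding golay_code_eq by (rule vec.span_diff)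

lemma golay_subset:
  assumes "vec.subspace V" "\<And>i. golay_gen i \<in> V"
  shows "golay_code \<subseteq> V"
  unfolding golay_code_eq using assms by (intro vec.span_minimal) auto

text \<open>All generators together cover infinity 23 times and every other point 11 times, both
  odd.\<close>

lemma golay_ones [simp]: "(\<chi> p. 1) \<in> golay_code"
proof -
  have "(\<Sum>i\<in>UNIV. golay_gen i) $ p = 1" for p
  proof (cases p)
    case None
    then show ?thesis by (simp add: sum_23)
  next
    case (Some j)
    have "(\<Sum>i\<in>UNIV. golay_gen i) $ p = (\<Sum>i\<in>UNIV. of_bool (square23 (j - i)))"
      by (simp add: Some golay_gen_Some)
    also have "\<dots> = (\<Sum>x\<in>UNIV. of_bool (square23 x))"
      by (rule sum.reindex_bij_witness[of _ "\<lambda>x. j - x" "\<lambda>x. j - x"]) auto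
    also have "\<dots> = 1" unfolding sum_23 by (simp add: square23_iff)
    finally show ?thesis .
  qed
  then have "(\<chi> p. 1) = (\<Sum>i\<in>UNIV. golay_gen i)" by (simp add: vec_eq_iff)
  then show ?thesis unfolding golay_code_eq by (simp add: vec.span_sum vec.span_base)
qed

text \<open>Two generators share infinity and an odd number of finite points: 11 if they coincide
  and otherwise 5, the nonzero squares being the Paley difference set. To count,
  \<open>j = i * k\<close> rescales the shift to 1; then k and k - 1 are both squares or both
  nonsquares, according to the character of \<open>i\<close>.\<close>

lemma golay_orthogonal:
  assumes "w \<in> golay_code"
  shows "(\<Sum>p\<in>UNIV. golay_gen 0 $ p * w $ p) = 0"
proof -
  have gen: "(\<Sum>p\<in>UNIV. golay_gen 0 $ p * golay_gen i $ p) = 0" for i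
  proof -
    have "(\<Sum>p\<in>UNIV. golay_gen 0 $ p * golay_gen i $ p) =
        1 + (\<Sum>j\<in>UNIV. of_bool (square23 j \<and> square23 (j - i)))"
      by (simp add: UNIV_option_conv sum.reindex golay_gen_Some of_bool_conj)
    also have "(\<Sum>j\<in>UNIV. of_bool (square23 j \<and> square23 (j - i))) = (1 :: bit)"
    proof (cases "i = 0")
      case True
      then show ?thesis unfolding sum_23 by (simp add: square23_iff)
    next
      case False
      have inv: "i * i ^ 21 = 1" "i ^ 21 * i = 1" using mult_power_21[OF False] by (simp_all add: mult.commute)
      have sqm: "square23 (i * x) \<longleftrightarrow> x \<noteq> 0 \<and> (square23 i \<longleftrightarrow> square23 x)" for x
        using square23_mult[OF False, of x] by (cases "x = 0") auto
      have "(\<Sum>j\<in>UNIV. of_bool (square23 j \<and> square23 (j - i))) =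
          (\<Sum>k\<in>UNIV. of_bool (square23 (i * k) \<and> square23 (i * (k - 1))) :: bit)"
        by (rule sum.reindex_bij_witness[of _ "\<lambda>k. i * k" "\<lambda>j. i ^ 21 * j"])
          (simp_all add: inv mult.assoc[symmetric] right_diff_distrib)
      also have "\<dots> = (\<Sum>k\<in>UNIV. of_bool (k \<noteq> 0 \<and> k \<noteq> 1 \<and>
          (square23 i \<longleftrightarrow> square23 k) \<and> (square23 i \<longleftrightarrow> square23 (k - 1))))"
        by (rule sum.cong) (auto simp: sqm)
      also have "\<dots> = 1" unfolding sum_23
        by (cases "square23 i") (simp_all add: square23_iff[of "numeral _"] square23_iff[of 1])
      finally show ?thesis .
    qed
    finally show ?thesis by simp
  qed
  let ?V = "{w. (\<Sum>p\<in>UNIV. golay_gen 0 $ p * w $ p) = 0}"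
  have "vec.subspace ?V"
    unfolding vec.subspace_def
    by (simp add: distrib_left sum.distrib mult.left_commute flip: sum_distrib_left)
  then have "golay_code \<subseteq> ?V" using gen by (intro golay_subset) auto
  then show ?thesis using assms by auto
qed

definition golay_aut :: "(23 option \<Rightarrow> 23 option) \<Rightarrow> bool" where
  "golay_aut f \<longleftrightarrow> bij f \<and> (\<forall>w\<in>golay_code. (\<chi> p. w $ f p) \<in> golay_code)"

lemma golay_autI:
  assumes "bij f" "\<And>i. (\<chi> p. golay_gen i $ f p) \<in> golay_code"
  shows "golay_aut f"
proof -
  let ?V = "{w. (\<chi> p. w $ f p) \<in> golay_code}"
  have "vec.subspace ?V" unfolding vec.subspace_def
  proof (intro conjI ballI allI; simp)
    show "(\<chi> p. 0) \<in> golay_code" using golay_zero by (simp add: zero_vec_def)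
    fix x y :: "bit ^ (23 option)" and b :: bit
    assume x: "(\<chi> p. x $ f p) \<in> golay_code"
    have "(\<chi> p. b * x $ f p) = b *s (\<chi> p. x $ f p)" by (simp add: vec_eq_iff)
    then show "(\<chi> p. b * x $ f p) \<in> golay_code" using golay_scale[OF x] by simp
    assume y: "(\<chi> p. y $ f p) \<in> golay_code"
    have "(\<chi> p. x $ f p + y $ f p) = (\<chi> p. x $ f p) + (\<chi> p. y $ f p)" by (simp add: vec_eq_iff)
    then show "(\<chi> p. x $ f p + y $ f p) \<in> golay_code" using golay_add[OF x y] by simp
  qed
  then have "golay_code \<subseteq> ?V" using assms(2) by (intro golay_subset) auto
  then show ?thesis using assms(1) unfolding golay_aut_def by blast
qed

definition translate :: "23 \<Rightarrow> 23 option \<Rightarrow> 23 option" where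
  "translate a = map_option (\<lambda>j. j + a)"

lemma golay_aut_translate: "golay_aut (translate a)"
proof (rule golay_autI)
  show "bij (translate a)"
    by (rule o_bij[of "translate (- a)"]) (auto simp: translate_def fun_eq_iff option.map_comp o_def option.map_ident)
  show "(\<chi> p. golay_gen i $ translate a p) \<in> golay_code" for i
  proof -
    have "golay_gen i $ translate a p = golay_gen (i - a) $ p" for p
      by (cases p) (simp_all add: translate_def golay_gen_Some algebra_simps)
    then have "(\<chi> p. golay_gen i $ translate a p) = golay_gen (i - a)" by (simp add: vec_eq_iff)
    then show ?thesis by simp
  qed
qed

text \<open>Multiplying by a square does not change the character, so generator \<open>i\<close>
  becomes generator i/u.\<close>

lemma golay_aut_scale:
  assumes u: "square23 u"
  shows "golay_aut (map_option ((*) u))"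
proof (rule golay_autI)
  have u0: "u \<noteq> 0" using u by auto
  have inv: "u * u ^ 21 = 1" "u ^ 21 * u = 1" using mult_power_21[OF u0] by (simp_all add: mult.commute)
  show "bij (map_option ((*) u))"
    by (rule o_bij[of "map_option ((*) (u ^ 21))"])
      (auto simp: fun_eq_iff option.map_comp o_def mult.assoc[symmetric] inv option.map_ident)
  show "(\<chi> p. golay_gen i $ map_option ((*) u) p) \<in> golay_code" for i
  proof -
    have "square23 (u * j - i) \<longleftrightarrow> square23 (j - u ^ 21 * i)" for j
    proof -
      have *: "u * j - i = u * (j - u ^ 21 * i)" by (simp add: right_diff_distrib mult.assoc[symmetric] inv)
      show ?thesis unfolding * using u u0 square23_mult[of u] by (cases "j - u ^ 21 * i = 0") auto
    qed
    then have "golay_gen i $ map_option ((*) u) p = golay_gen (u ^ 21 * i) $ p" for p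
      by (cases p) (simp_all add: golay_gen_Some)
    then have "(\<chi> p. golay_gen i $ map_option ((*) u) p) = golay_gen (u ^ 21 * i)" by (simp add: vec_eq_iff)
    then show ?thesis by simp
  qed
qed

text \<open>The map \<open>z \<mapsto> -1/z\<close>. The type \<open>23\<close> is only a ring, so the reciprocal of \<open>z\<close> is written \<open>z ^ 21\<close>.\<close>

definition neg_recip :: "23 option \<Rightarrow> 23 option" where
  "neg_recip p = (case p of None \<Rightarrow> Some 0 | Some j \<Rightarrow> if j = 0 then None else Some (- (j ^ 21)))"

text \<open>441 = 21 * 21 = 20 * 22 + 1: taking the reciprocal twice is the identity, also at
  0.\<close>

lemma power_441: "(x :: 23) ^ 441 = x"
proof (cases "x = 0")
  case False
  have "x ^ 441 = (x ^ 22) ^ 20 * x" by (simp flip: power_mult power_Suc2)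
  then show ?thesis unfolding power_22[OF False] by simp
qed simp

lemma power_21_eq_0_iff: "(x :: 23) ^ 21 = 0 \<longleftrightarrow> x = 0"
  by (cases "x = 0") (use mult_power_21[of x] in auto)

lemma square23_power_21: "square23 (x ^ 21) \<longleftrightarrow> square23 x"
proof (cases "x = 0")
  case False
  define y where "y = x ^ 11"
  have "(x ^ 21) ^ 11 = y ^ 21" by (simp add: y_def flip: power_mult)
  moreover have "y = 1 \<or> y = -1" unfolding y_def using power_11_cases[OF False] .
  ultimately show ?thesis unfolding square23_iff y_def[symmetric] by auto
qed simp

lemma neg_recip_neg_recip: "neg_recip (neg_recip p) = p"
  by (cases p) (auto simp: neg_recip_def power_21_eq_0_iff power_441)

text \<open>This is the Gleason--Prange theorem for the code at hand. For \<open>i \<noteq> 0\<close> it rests on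
  \<open>-1/j - i = - (i/j) * (j + 1/i)\<close> and the multiplicativity of the quadratic character.\<close>

lemma golay_aut_neg_recip: "golay_aut neg_recip"
proof (rule golay_autI)
  show "bij neg_recip" by (rule o_bij[of neg_recip]) (auto simp: neg_recip_neg_recip)
  show "(\<chi> p. golay_gen i $ neg_recip p) \<in> golay_code" for i
  proof (cases "i = 0")
    case True
    \<comment> \<open>Squares and nonsquares are exchanged, as are 0 and infinity, so this generator
      becomes its complement.\<close>
    have "golay_gen 0 $ neg_recip p = golay_gen 0 $ p + 1" for p
      by (cases p) (auto simp: neg_recip_def golay_gen_Some power_21_eq_0_iff square23_minus square23_power_21)
    then have "(\<chi> p. golay_gen i $ neg_recip p) = golay_gen 0 + (\<chi> p. 1)"
      by (simp add: vec_eq_iff True)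
    then show ?thesis by (simp add: golay_add)
  next
    case False
    define k where "k = - (i ^ 21)"
    have k0: "k \<noteq> 0" using False by (simp add: k_def power_21_eq_0_iff)
    have ik: "i * k = -1" using mult_power_21[OF False] by (simp add: k_def)
    have sq_k: "square23 k \<longleftrightarrow> \<not> square23 i"
      using False by (simp add: k_def square23_minus power_21_eq_0_iff square23_power_21)
    \<comment> \<open>With k = -1/i, the product of characters becomes a sum of bits, and the
      constant bit absorbs the character of \<open>i\<close>. The points infinity, 0 and k, where a
      character degenerates, are checked separately.\<close>
    have "golay_gen i $ neg_recip p = golay_gen k $ p + golay_gen 0 $ p + of_bool (\<not> square23 i)" for p
    proof (cases p)
      case None
      then show ?thesis using False by (simp add: neg_recip_def golay_gen_Some square23_minus)
    next
      case (Some j)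
      show ?thesis
      proof (cases "j = 0")
        case True
        then show ?thesis
          using k0 by (simp add: Some neg_recip_def golay_gen_Some square23_minus sq_k)
      next
        case j: False
        have jj: "j ^ 21 * j = 1" using mult_power_21[OF j] by (simp add: mult.commute)
        have "- (i * j ^ 21) * (j - k) = - (i * (j ^ 21 * j)) + j ^ 21 * (i * k)"
          by (simp add: algebra_simps)
        then have eq: "- (j ^ 21) - i = - (i * j ^ 21) * (j - k)" by (simp add: jj ik)
        have "square23 (- (j ^ 21) - i) \<longleftrightarrow> j \<noteq> k \<and> (square23 (j - k) \<longleftrightarrow> (square23 j \<longleftrightarrow> \<not> square23 i))"
        proof (cases "j = k")
          case False
          have "i * j ^ 21 \<noteq> 0" using \<open>i \<noteq> 0\<close> j by (simp add: mult_23_eq_0_iff power_21_eq_0_iff)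
          then have "square23 (- (i * j ^ 21) * (j - k)) \<longleftrightarrow> (\<not> square23 (i * j ^ 21) \<longleftrightarrow> square23 (j - k))"
            using False by (subst square23_mult) (auto simp: square23_minus)
          also have "square23 (i * j ^ 21) \<longleftrightarrow> (square23 i \<longleftrightarrow> square23 j)"
            using \<open>i \<noteq> 0\<close> j by (simp add: square23_mult power_21_eq_0_iff square23_power_21)
          finally show ?thesis using False unfolding eq by blast
        next
          case True
          then show ?thesis unfolding eq by simp
        qed
        then show ?thesis using j sq_k
          by (cases "j = k") (auto simp: Some neg_recip_def golay_gen_Some)
      qed
    qed
    then have "(\<chi> p. golay_gen i $ neg_recip p) =
        golay_gen k + golay_gen 0 + of_bool (\<not> square23 i) *s (\<chi> p. 1)"
      by (simp add: vec_eq_iff)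
    then show ?thesis by (simp add: golay_add golay_scale)
  qed
qed

text \<open>Writing z = m + 2w makes the conditions additive. The class of k modulo 4 is empty if k
  - m is odd and otherwise is the word w modulo 2 or its complement, which is harmless as the
  all-ones word is in the code. The sum 24m + 2 sum(w) turns the condition modulo 8 into one modulo
  4.\<close>

lemma Leech_lattice_iff:
  "x \<in> Leech_lattice \<longleftrightarrow> (\<exists>(m::int) w :: int ^ (23 option).
     x = (\<chi> p. of_int (m + 2 * w $ p) / sqrt 8) \<and>
     (\<chi> p. of_int (w $ p)) \<in> golay_code \<and> [(\<Sum>p\<in>UNIV. w $ p) = 2 * m] (mod 4))"
    (is "_ \<longleftrightarrow> (\<exists>m w. ?P x m w)")
proof
  have card: "CARD(23 option) = 24" by (simp add: UNIV_option_conv card_image)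
  {
    assume "x \<in> Leech_lattice"
    then obtain z :: "int ^ (23 option)" and m :: int where x: "x = (\<chi> p. of_int (z $ p) / sqrt 8)"
      and m: "\<And>p. [z $ p = m] (mod 2)" and sum: "[(\<Sum>p\<in>UNIV. z $ p) = 4 * m] (mod 8)"
      and golay: "\<And>k::int. (\<chi> p. of_bool ([z $ p = k] (mod 4))) \<in> golay_code"
      unfolding Leech_lattice_def by blast
    define w where "w = (\<chi> p. (z $ p - m) div 2)"
    have z: "z $ p = m + 2 * w $ p" for p
      using m[of p] unfolding w_def cong_iff_dvd_diff by simp
    have "of_int (w $ p) = of_bool ([z $ p = m] (mod 4)) + (1 :: bit)" for p
    proof -
      have "[z $ p = m] (mod 4) \<longleftrightarrow> even (w $ p)" unfolding z cong_iff_dvd_diff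
        by (simp add: dvd_mult_cancel_left[of 2 2, simplified])
      then show ?thesis using of_int_bit_eq_0_iff[of "w $ p"] by auto
    qed
    then have "(\<chi> p. of_int (w $ p)) = (\<chi> p. of_bool ([z $ p = m] (mod 4))) + (\<chi> p. (1 :: bit))"
      by (simp add: vec_eq_iff)
    then have "(\<chi> p. of_int (w $ p)) \<in> golay_code" using golay_add[OF golay golay_ones] by simp
    moreover have "[(\<Sum>p\<in>UNIV. w $ p) = 2 * m] (mod 4)"
    proof -
      have "(\<Sum>p\<in>UNIV. z $ p) = 24 * m + 2 * (\<Sum>p\<in>UNIV. w $ p)"
        by (simp add: z sum.distrib card sum_distrib_left)
      then have "8 dvd 24 * m + 2 * (\<Sum>p\<in>UNIV. w $ p) - 4 * m"
        using sum by (simp add: cong_iff_dvd_diff)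
      then show ?thesis unfolding cong_iff_dvd_diff by presburger
    qed
    ultimately show "\<exists>m w. ?P x m w" using x z by auto
  }
  {
    assume "\<exists>m w. ?P x m w"
    then obtain m w where P: "?P x m w" by blast
    define z where "z = (\<chi> p. m + 2 * w $ p)"
    have "(\<Sum>p\<in>UNIV. z $ p) = 24 * m + 2 * (\<Sum>p\<in>UNIV. w $ p)"
      by (simp add: z_def sum.distrib card sum_distrib_left)
    moreover have "4 dvd (\<Sum>p\<in>UNIV. w $ p) - 2 * m" using P by (simp add: cong_iff_dvd_diff)
    ultimately have "[(\<Sum>p\<in>UNIV. z $ p) = 4 * m] (mod 8)" unfolding cong_iff_dvd_diff by presburger
    moreover have "(\<chi> p. of_bool ([z $ p = k] (mod 4))) \<in> golay_code" for k
    proof (cases "even (k - m)")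
      case True
      then obtain l where l: "k = m + 2 * l" by (metis add_diff_cancel_left' diff_add_cancel evenE add.commute)
      have "of_bool ([z $ p = k] (mod 4)) = of_int (w $ p) + of_int (l + 1) * (1 :: bit)" for p
      proof -
        have "[z $ p = k] (mod 4) \<longleftrightarrow> even (w $ p + l)"
          unfolding z_def l cong_iff_dvd_diff by simp presburger
        then show ?thesis using of_int_bit_eq_0_iff[of "w $ p + l + 1"] by (auto simp: add.assoc)
      qed
      then have "(\<chi> p. of_bool ([z $ p = k] (mod 4))) =
          (\<chi> p. of_int (w $ p)) + of_int (l + 1) *s (\<chi> p. (1 :: bit))" by (simp add: vec_eq_iff)
      then show ?thesis using P by (simp only: golay_add golay_scale golay_ones)
    next
      case False
      have "\<not> [z $ p = k] (mod 4)" for p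
        using False unfolding z_def cong_iff_dvd_diff by simp presburger
      then have "(\<chi> p. of_bool ([z $ p = k] (mod 4))) = (0 :: bit ^ (23 option))" by (simp add: vec_eq_iff)
      then show ?thesis by simp
    qed
    moreover have "[z $ p = m] (mod 2)" for p by (simp add: z_def cong_iff_dvd_diff)
    moreover have "x = (\<chi> p. of_int (z $ p) / sqrt 8)" using P by (simp add: z_def)
    ultimately show "x \<in> Leech_lattice" unfolding Leech_lattice_def by blast
  }
qed

lemma Leech_lattice_diff:
  assumes "x \<in> Leech_lattice" "y \<in> Leech_lattice"
  shows "x - y \<in> Leech_lattice"
proof -
  obtain m w where x: "x = (\<chi> p. of_int (m + 2 * w $ p) / sqrt 8)"
    "(\<chi> p. of_int (w $ p)) \<in> golay_code" "[(\<Sum>p\<in>UNIV. w $ p) = 2 * m] (mod 4)"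
    using assms(1) unfolding Leech_lattice_iff by blast
  obtain n v where y: "y = (\<chi> p. of_int (n + 2 * v $ p) / sqrt 8)"
    "(\<chi> p. of_int (v $ p)) \<in> golay_code" "[(\<Sum>p\<in>UNIV. v $ p) = 2 * n] (mod 4)"
    using assms(2) unfolding Leech_lattice_iff by blast
  have "x - y = (\<chi> p. of_int ((m - n) + 2 * (w - v) $ p) / sqrt 8)"
    unfolding x(1) y(1) by (simp add: vec_eq_iff diff_divide_distrib[symmetric])
  moreover have "(\<chi> p. of_int ((w - v) $ p)) = (\<chi> p. of_int (w $ p)) - (\<chi> p. (of_int (v $ p) :: bit))"
    by (simp add: vec_eq_iff)
  then have "(\<chi> p. of_int ((w - v) $ p)) \<in> golay_code" using golay_diff[OF x(2) y(2)] by simp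
  moreover have "[(\<Sum>p\<in>UNIV. (w - v) $ p) = 2 * (m - n)] (mod 4)"
    using cong_diff[OF x(3) y(3)] by (simp add: sum_subtractf right_diff_distrib)
  ultimately show ?thesis unfolding Leech_lattice_iff by blast
qed

lemma Leech_lattice_permute:
  assumes "golay_aut f" "x \<in> Leech_lattice"
  shows "(\<chi> p. x $ f p) \<in> Leech_lattice"
proof -
  obtain m w where x: "x = (\<chi> p. of_int (m + 2 * w $ p) / sqrt 8)"
    "(\<chi> p. of_int (w $ p)) \<in> golay_code" "[(\<Sum>p\<in>UNIV. w $ p) = 2 * m] (mod 4)"
    using assms(2) unfolding Leech_lattice_iff by blast
  define v where "v = (\<chi> p. w $ f p)"
  have "(\<Sum>p\<in>UNIV. v $ p) = (\<Sum>p\<in>UNIV. w $ p)"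
    using assms(1) sum.reindex_bij_betw[of f UNIV UNIV "\<lambda>p. w $ p"] by (simp add: golay_aut_def v_def)
  then have "[(\<Sum>p\<in>UNIV. v $ p) = 2 * m] (mod 4)" using x(3) by simp
  moreover have "(\<chi> p. of_int (v $ p)) \<in> golay_code"
    using assms(1) x(2) unfolding golay_aut_def by (force simp: v_def)
  moreover have "(\<chi> p. x $ f p) = (\<chi> p. of_int (m + 2 * v $ p) / sqrt 8)"
    by (simp add: x(1) v_def)
  ultimately show ?thesis unfolding Leech_lattice_iff by blast
qed

definition golay_sign :: "23 option \<Rightarrow> real" where
  "golay_sign p = (if golay_gen 0 $ p = 0 then 1 else -1)"

text \<open>Negating m + 2w on the codeword \<open>g\<close> replaces w by w - (m + 2w) g, so w
  changes by m g modulo 2. Its sum drops by 12 m + 2 sum(g w), a multiple of 4: the word has weight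
  12 and is orthogonal to w modulo 2.\<close>

lemma Leech_lattice_sign:
  assumes "x \<in> Leech_lattice"
  shows "(\<chi> p. golay_sign p * x $ p) \<in> Leech_lattice"
proof -
  obtain m w where x: "x = (\<chi> p. of_int (m + 2 * w $ p) / sqrt 8)"
    "(\<chi> p. of_int (w $ p)) \<in> golay_code" "[(\<Sum>p\<in>UNIV. w $ p) = 2 * m] (mod 4)"
    using assms unfolding Leech_lattice_iff by blast
  define g :: "23 option \<Rightarrow> int" where "g p = (if golay_gen 0 $ p = 0 then 0 else 1)" for p
  have g: "of_int (g p) = golay_gen 0 $ p" for p by (simp add: g_def)
  define v where "v = (\<chi> p. w $ p - (m + 2 * w $ p) * g p)"
  have "of_int (m + 2 * v $ p) = golay_sign p * of_int (m + 2 * w $ p)" for p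
    by (simp add: v_def g_def golay_sign_def)
  then have "(\<chi> p. golay_sign p * x $ p) = (\<chi> p. of_int (m + 2 * v $ p) / sqrt 8)"
    by (simp add: x(1))
  moreover have "(\<chi> p. of_int (v $ p)) = (\<chi> p. of_int (w $ p)) - of_int m *s golay_gen 0"
    by (simp add: vec_eq_iff v_def g)
  then have "(\<chi> p. of_int (v $ p)) \<in> golay_code" using golay_diff[OF x(2)] golay_scale by simp
  moreover have "[(\<Sum>p\<in>UNIV. v $ p) = 2 * m] (mod 4)"
  proof -
    have "(of_int (\<Sum>p\<in>UNIV. g p * w $ p) :: bit) = 0"
      using golay_orthogonal[OF x(2)] by (simp add: g)
    then have "even (\<Sum>p\<in>UNIV. g p * w $ p)" by (simp only: of_int_bit_eq_0_iff)
    then have "4 dvd 2 * (\<Sum>p\<in>UNIV. g p * w $ p)" by presburger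
    moreover have "(\<Sum>p\<in>UNIV. g p) = 12"
      by (simp add: UNIV_option_conv sum.reindex sum_23 g_def golay_gen_Some square23_iff)
    moreover have "(\<Sum>p\<in>UNIV. v $ p) = (\<Sum>p\<in>UNIV. w $ p) - m * (\<Sum>p\<in>UNIV. g p) - 2 * (\<Sum>p\<in>UNIV. g p * w $ p)"
      by (simp add: v_def sum_subtractf sum.distrib sum_distrib_left algebra_simps)
    ultimately show ?thesis using x(3) unfolding cong_iff_dvd_diff by presburger
  qed
  ultimately show ?thesis unfolding Leech_lattice_iff by blast
qed

text \<open>The first generator of a quaternion group acting on the Leech lattice is \<open>z \<mapsto> -1/z\<close> with the signs
  of \<^const>\<open>golay_sign\<close>. The second generator is \<open>z \<mapsto> 12 - 16/(z - 12)\<close>, a conjugate of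
  \<open>z \<mapsto> -16/z\<close> under a translation.\<close>

definition shifted_neg_recip :: "23 option \<Rightarrow> 23 option" where
  "shifted_neg_recip p = (case p of None \<Rightarrow> Some 12
    | Some j \<Rightarrow> if j = 12 then None else Some (12 - 16 * (j - 12) ^ 21))"

definition shifted_golay_sign :: "23 option \<Rightarrow> real" where
  "shifted_golay_sign p = golay_sign (translate (- 12) p)"

lemma neg_recip_table:
  "neg_recip None = Some 0" "neg_recip (Some 0) = None" "neg_recip (Some 1) = Some 22"
  "neg_recip (Some 2) = Some 11" "neg_recip (Some 3) = Some 15" "neg_recip (Some 4) = Some 17"
  "neg_recip (Some 5) = Some 9" "neg_recip (Some 6) = Some 19" "neg_recip (Some 7) = Some 13"
  "neg_recip (Some 8) = Some 20" "neg_recip (Some 9) = Some 5" "neg_recip (Some 10) = Some 16"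
  "neg_recip (Some 11) = Some 2" "neg_recip (Some 12) = Some 21" "neg_recip (Some 13) = Some 7"
  "neg_recip (Some 14) = Some 18" "neg_recip (Some 15) = Some 3" "neg_recip (Some 16) = Some 10"
  "neg_recip (Some 17) = Some 4" "neg_recip (Some 18) = Some 14" "neg_recip (Some 19) = Some 6"
  "neg_recip (Some 20) = Some 8" "neg_recip (Some 21) = Some 12" "neg_recip (Some 22) = Some 1"
  by (simp_all add: neg_recip_def)

lemma shifted_neg_recip_table:
  "shifted_neg_recip None = Some 12" "shifted_neg_recip (Some 0) = Some 21" "shifted_neg_recip (Some 1) = Some 3"
  "shifted_neg_recip (Some 2) = Some 9" "shifted_neg_recip (Some 3) = Some 1" "shifted_neg_recip (Some 4) = Some 14"
  "shifted_neg_recip (Some 5) = Some 11" "shifted_neg_recip (Some 6) = Some 7" "shifted_neg_recip (Some 7) = Some 6"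
  "shifted_neg_recip (Some 8) = Some 16" "shifted_neg_recip (Some 9) = Some 2" "shifted_neg_recip (Some 10) = Some 20"
  "shifted_neg_recip (Some 11) = Some 5" "shifted_neg_recip (Some 12) = None" "shifted_neg_recip (Some 13) = Some 19"
  "shifted_neg_recip (Some 14) = Some 4" "shifted_neg_recip (Some 15) = Some 22" "shifted_neg_recip (Some 16) = Some 8"
  "shifted_neg_recip (Some 17) = Some 18" "shifted_neg_recip (Some 18) = Some 17" "shifted_neg_recip (Some 19) = Some 13"
  "shifted_neg_recip (Some 20) = Some 10" "shifted_neg_recip (Some 21) = Some 0" "shifted_neg_recip (Some 22) = Some 15"
  by (simp_all add: shifted_neg_recip_def)

lemma golay_sign_table:
  "golay_sign None = - 1" "golay_sign (Some 0) = 1" "golay_sign (Some 1) = - 1"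
  "golay_sign (Some 2) = - 1" "golay_sign (Some 3) = - 1" "golay_sign (Some 4) = - 1"
  "golay_sign (Some 5) = 1" "golay_sign (Some 6) = - 1" "golay_sign (Some 7) = 1"
  "golay_sign (Some 8) = - 1" "golay_sign (Some 9) = - 1" "golay_sign (Some 10) = 1"
  "golay_sign (Some 11) = 1" "golay_sign (Some 12) = - 1" "golay_sign (Some 13) = - 1"
  "golay_sign (Some 14) = 1" "golay_sign (Some 15) = 1" "golay_sign (Some 16) = - 1"
  "golay_sign (Some 17) = 1" "golay_sign (Some 18) = - 1" "golay_sign (Some 19) = 1"
  "golay_sign (Some 20) = 1" "golay_sign (Some 21) = 1" "golay_sign (Some 22) = 1"
  by (simp_all add: golay_sign_def golay_gen_Some square23_iff)

lemma shifted_golay_sign_table: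
  "shifted_golay_sign None = - 1" "shifted_golay_sign (Some 0) = 1" "shifted_golay_sign (Some 1) = - 1"
  "shifted_golay_sign (Some 2) = - 1" "shifted_golay_sign (Some 3) = 1" "shifted_golay_sign (Some 4) = 1"
  "shifted_golay_sign (Some 5) = - 1" "shifted_golay_sign (Some 6) = 1" "shifted_golay_sign (Some 7) = - 1"
  "shifted_golay_sign (Some 8) = 1" "shifted_golay_sign (Some 9) = 1" "shifted_golay_sign (Some 10) = 1"
  "shifted_golay_sign (Some 11) = 1" "shifted_golay_sign (Some 12) = 1" "shifted_golay_sign (Some 13) = - 1"
  "shifted_golay_sign (Some 14) = - 1" "shifted_golay_sign (Some 15) = - 1" "shifted_golay_sign (Some 16) = - 1"
  "shifted_golay_sign (Some 17) = 1" "shifted_golay_sign (Some 18) = - 1" "shifted_golay_sign (Some 19) = 1"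
  "shifted_golay_sign (Some 20) = - 1" "shifted_golay_sign (Some 21) = - 1" "shifted_golay_sign (Some 22) = 1"
  by (simp_all add: shifted_golay_sign_def translate_def golay_sign_def golay_gen_Some square23_iff)

text \<open>The matrices anticommute by construction, but their signed lifts to 24 coordinates must
  be compared sign by sign; the tables settle this at every point.\<close>

interpretation leech: quaternion_signed_perms golay_sign shifted_golay_sign neg_recip shifted_neg_recip
proof -
  note tables = neg_recip_table shifted_neg_recip_table golay_sign_table shifted_golay_sign_table
  have "\<forall>p. neg_recip (neg_recip p) = p \<and> shifted_neg_recip (shifted_neg_recip p) = p"
    "\<forall>p. golay_sign p \<in> {1, -1} \<and> shifted_golay_sign p \<in> {1, -1}"
    "\<forall>p. golay_sign p * golay_sign (neg_recip p) = -1"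
    "\<forall>p. shifted_golay_sign p * shifted_golay_sign (shifted_neg_recip p) = -1"
    "\<forall>p. neg_recip (shifted_neg_recip p) = shifted_neg_recip (neg_recip p)"
    "\<forall>p. golay_sign p * shifted_golay_sign (neg_recip p) =
      - (shifted_golay_sign p * golay_sign (shifted_neg_recip p))"
    unfolding forall_23_option by (simp_all add: tables)
  then show "quaternion_signed_perms golay_sign shifted_golay_sign neg_recip shifted_neg_recip"
    unfolding quaternion_signed_perms_def by blast
qed

lemma Leech_multiplier: "\<exists>\<sigma>. multiplier (real c) Leech_lattice \<sigma>"
proof (rule leech.multiplier_exists)
  have I: "signed_perm golay_sign neg_recip u \<in> Leech_lattice" if "u \<in> Leech_lattice" for u
    using Leech_lattice_sign[OF Leech_lattice_permute[OF golay_aut_neg_recip that]]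
    by (simp add: signed_perm_def)
  then show "signed_perm golay_sign neg_recip u \<in> Leech_lattice" if "u \<in> Leech_lattice" for u
    using that .
  show "signed_perm shifted_golay_sign shifted_neg_recip u \<in> Leech_lattice" if "u \<in> Leech_lattice" for u
  proof -
    \<comment> \<open>Translation by 12, scaling by 16 and the inverse translation carry the first
      generator to the second. They are precomposed with \<open>u\<close>, so the outermost map of
      \<open>shifted_neg_recip\<close> is applied first.\<close>
    have "square23 16" by (simp add: square23_iff)
    define v where "v = (\<chi> p. (\<chi> p. u $ translate 12 p) $ map_option ((*) 16) p)"
    have "v \<in> Leech_lattice" unfolding v_def
      by (intro Leech_lattice_permute golay_aut_scale golay_aut_translate \<open>square23 16\<close> that)
    then have "(\<chi> p. signed_perm golay_sign neg_recip v $ translate (- 12) p) \<in> Leech_lattice"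
      by (intro Leech_lattice_permute golay_aut_translate I)
    moreover have "shifted_neg_recip p = translate 12 (map_option ((*) 16) (neg_recip (translate (- 12) p)))" for p
      by (cases p) (auto simp: shifted_neg_recip_def neg_recip_def translate_def)
    then have "(\<chi> p. signed_perm golay_sign neg_recip v $ translate (- 12) p) =
        signed_perm shifted_golay_sign shifted_neg_recip u"
      by (simp add: vec_eq_iff shifted_golay_sign_def v_def)
    ultimately show ?thesis by simp
  qed
qed (rule Leech_lattice_diff)

theorem theorem3:
  fixes c :: nat
  assumes "c \<ge> 1"
  shows "(\<forall>m\<ge>1. CARD('n::finite) = 4 * m \<longrightarrow>
            (\<exists>\<sigma>. multiplier (real c) (Z_lattice :: (real ^ 'n) set) \<sigma>) \<and>
            (\<exists>\<sigma>. multiplier (real c) (D_lattice :: (real ^ 'n) set) \<sigma>) \<and>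
            (\<exists>\<sigma>. multiplier (real c) (D_plus :: (real ^ 'n) set) \<sigma>)) \<and>
         (\<exists>\<sigma>. multiplier (real c) E8_lattice \<sigma>) \<and>
         (\<exists>\<sigma>. multiplier (real c) K12_lattice \<sigma>) \<and>
         (\<exists>\<sigma>. multiplier (real c) BW16_lattice \<sigma>) \<and>
         (\<exists>\<sigma>. multiplier (real c) Leech_lattice \<sigma>)"
  using cubic_multipliers(3)[where 'n = 8 and m = 2] K12_multiplier BW16_multiplier Leech_multiplier
  by (auto simp: E8_lattice_def intro: cubic_multipliers)

end
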